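(* Let $R$ be a commutative ring, let $\mathcal A$ and $\mathcal A'$ be two associative $R$-algebras with formal deformations $(\mathcal A[[\nu]],\star)$ and $(\mathcal A'[[\nu]],\star')$, and let $F=F_0+\nu F_1+\nu^2F_2+\cdots:\mathcal A[[\nu]]\to\mathcal A'[[\nu]]$ be a morphism of $R[[\nu]]$-algebras (where the $F_i:\mathcal A\to\mathcal A'$ are $R$-linear maps, extended $R[[\nu]]$-linearly). If $F_0(Z(\mathcal A))\subset Z(\mathcal A')$, then $F$ restricts to a morphism of Poisson algebras $F:(\mathcal H_\nu,[\cdot,\cdot]_\nu)\to(\mathcal H'_\nu,[\cdot,\cdot]'_\nu)$ and induces a map $F_\Pi:\Pi(\mathcal A)\to\Pi(\mathcal A')$ (that is, $F_\Pi\circ p_\Pi=p_{\Pi'}\circ F$ on $\mathcal H_\nu$). Moreover, $F_\Pi$ and the map induced by it between the reduced Poisson algebras $(Z(\mathcal A),\{\cdot,\cdot\}_1)$ and $(Z(\mathcal A'),\{\cdot,\cdot\}'_1)$ are morphisms of Poisson algebras.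
   Context: Associative algebras are unital and not necessarily commutative; $Z(\cdot)$ denotes the center and $[a,b]=ab-ba$. A (not necessarily commutative) Poisson algebra is an associative algebra with a Lie bracket satisfying $\{a,bc\}=\{a,b\}c+b\{a,c\}$; a morphism of Poisson algebras is a map which is both an algebra and a Lie algebra morphism. A formal deformation of $\mathcal A$ is an associative $R[[\nu]]$-algebra structure $\star$ on $\mathcal A[[\nu]]$ with $a\star b-ab\in\nu\mathcal A[[\nu]]$ for $a,b\in\mathcal A$. For $a,b\in\mathcal A$ write $a\star b=ab+\sum_{i\ge1}\nu^i(a,b)_i$ and $a\star b-b\star a=[a,b]+\sum_{i\ge1}\nu^i\{a,b\}_i$. $\mathcal H_\nu:=Z(\mathcal A)+\nu\mathcal A[[\nu]]$, with product $\star$ and bracket $[A,B]_\nu:=\frac1\nu(A\star B-B\star A)$, is a Poisson algebra, and $\nu\mathcal H_\nu$ is a Poisson ideal of it. The quotient $\mathcal H_\nu/\nu\mathcal H_\nu$ is a commutative Poisson algebra, identified with $\Pi(\mathcal A):=Z(\mathcal A)\times(\mathcal A/Z(\mathcal A))$ (quotient of $R$-modules, $\overline b=b+Z(\mathcal A)$) so that the canonical projection is $p_\Pi:\mathcal H_\nu\to\Pi(\mathcal A)$, $a_0+\nu a_1+\nu^2a_2+\cdots\mapsto(a_0,\overline{a_1})$. Explicitly, $(a,\overline{a_1})\cdot(b,\overline{b_1})=(ab,\overline{ab_1+a_1b+(a,b)_1})$ and $\{(a,\overline{a_1}),(b,\overline{b_1})\}=(\{a,b\}_1,\overline{\{a,b\}_2+\{a_1,b\}_1+\{a,b_1\}_1+[a_1,b_1]})$.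 Reduced Poisson algebra: $\{0\}\times(\mathcal A/Z(\mathcal A))$ is a Poisson ideal of $\Pi(\mathcal A)$, and the quotient Poisson algebra is identified with $Z(\mathcal A)$ via $(a,\overline{a_1})\mapsto a$; its product is that of $\mathcal A$ and its Poisson bracket is $\{\cdot,\cdot\}_1$ restricted to $Z(\mathcal A)$. Primed objects ($\mathcal H'_\nu$, $[\cdot,\cdot]'_\nu$, $p_{\Pi'}$, $\{\cdot,\cdot\}'_1$, $\Pi(\mathcal A')$) are the corresponding objects for $(\mathcal A'[[\nu]],\star')$. *)

theory Defs
  imports "HOL-Algebra.Module" "HOL-Algebra.QuotRing"
begin

section \<open>Associative algebras and Poisson algebras\<close>

text \<open>The locale \<^locale>\<open>algebra\<close> of the library is restricted to commutative algebras.\<close>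

locale assoc_algebra = module R A + A?: ring A for R (structure) and A (structure) +
  assumes smult_mult_left:
      "\<lbrakk>r \<in> carrier R; x \<in> carrier A; y \<in> carrier A\<rbrakk>
        \<Longrightarrow> (r \<odot>\<^bsub>A\<^esub> x) \<otimes>\<^bsub>A\<^esub> y = r \<odot>\<^bsub>A\<^esub> (x \<otimes>\<^bsub>A\<^esub> y)"
    and smult_mult_right:
      "\<lbrakk>r \<in> carrier R; x \<in> carrier A; y \<in> carrier A\<rbrakk>
        \<Longrightarrow> x \<otimes>\<^bsub>A\<^esub> (r \<odot>\<^bsub>A\<^esub> y) = r \<odot>\<^bsub>A\<^esub> (x \<otimes>\<^bsub>A\<^esub> y)"

definition linear_maps ::
  "('r, 'k) ring_scheme \<Rightarrow> ('r, 'a, 'm) module_scheme \<Rightarrow> ('r, 'b, 'n) module_scheme \<Rightarrow> ('a \<Rightarrow> 'b) set"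
  where "linear_maps R M N =
    {f \<in> carrier M \<rightarrow> carrier N.
      (\<forall>x\<in>carrier M. \<forall>y\<in>carrier M. f (x \<oplus>\<^bsub>M\<^esub> y) = f x \<oplus>\<^bsub>N\<^esub> f y) \<and>
      (\<forall>r\<in>carrier R. \<forall>x\<in>carrier M. f (r \<odot>\<^bsub>M\<^esub> x) = r \<odot>\<^bsub>N\<^esub> f x)}"

definition algebra_hom ::
  "('r, 'k) ring_scheme \<Rightarrow> ('r, 'a, 'm) module_scheme \<Rightarrow> ('r, 'b, 'n) module_scheme \<Rightarrow> ('a \<Rightarrow> 'b) set"
  where "algebra_hom R A B = ring_hom A B \<inter> linear_maps R A B"

definition center :: "('a, 'm) ring_scheme \<Rightarrow> 'a set"
  where "center A = {z \<in> carrier A. \<forall>x\<in>carrier A. z \<otimes>\<^bsub>A\<^esub> x = x \<otimes>\<^bsub>A\<^esub> z}"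

definition commutator :: "('a, 'm) ring_scheme \<Rightarrow> 'a \<Rightarrow> 'a \<Rightarrow> 'a"
  where "commutator A x y = (x \<otimes>\<^bsub>A\<^esub> y) \<ominus>\<^bsub>A\<^esub> (y \<otimes>\<^bsub>A\<^esub> x)"

record ('r, 'a) poisson = "('r, 'a) module" +
  bracket :: "'a \<Rightarrow> 'a \<Rightarrow> 'a"

text \<open>The product is not assumed to be commutative.\<close>

locale poisson_algebra = assoc_algebra R P
  for R :: "('r, 'k) ring_scheme" (structure) and P :: "('r, 'a, 'm) poisson_scheme" (structure) +
  assumes bracket_closed:
      "\<lbrakk>x \<in> carrier P; y \<in> carrier P\<rbrakk> \<Longrightarrow> bracket P x y \<in> carrier P"
    and bracket_add_left:
      "\<lbrakk>x \<in> carrier P; y \<in> carrier P; z \<in> carrier P\<rbrakk>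
        \<Longrightarrow> bracket P (x \<oplus>\<^bsub>P\<^esub> y) z = bracket P x z \<oplus>\<^bsub>P\<^esub> bracket P y z"
    and bracket_add_right:
      "\<lbrakk>x \<in> carrier P; y \<in> carrier P; z \<in> carrier P\<rbrakk>
        \<Longrightarrow> bracket P x (y \<oplus>\<^bsub>P\<^esub> z) = bracket P x y \<oplus>\<^bsub>P\<^esub> bracket P x z"
    and bracket_smult_left:
      "\<lbrakk>r \<in> carrier R; x \<in> carrier P; y \<in> carrier P\<rbrakk>
        \<Longrightarrow> bracket P (r \<odot>\<^bsub>P\<^esub> x) y = r \<odot>\<^bsub>P\<^esub> bracket P x y"
    and bracket_smult_right:
      "\<lbrakk>r \<in> carrier R; x \<in> carrier P; y \<in> carrier P\<rbrakk>
        \<Longrightarrow> bracket P x (r \<odot>\<^bsub>P\<^esub> y) = r \<odot>\<^bsub>P\<^esub> bracket P x y"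
    and bracket_self:
      "x \<in> carrier P \<Longrightarrow> bracket P x x = \<zero>\<^bsub>P\<^esub>"
    and jacobi:
      "\<lbrakk>x \<in> carrier P; y \<in> carrier P; z \<in> carrier P\<rbrakk>
        \<Longrightarrow> bracket P x (bracket P y z) \<oplus>\<^bsub>P\<^esub> bracket P y (bracket P z x)
              \<oplus>\<^bsub>P\<^esub> bracket P z (bracket P x y) = \<zero>\<^bsub>P\<^esub>"
    and leibniz:
      "\<lbrakk>x \<in> carrier P; y \<in> carrier P; z \<in> carrier P\<rbrakk>
        \<Longrightarrow> bracket P x (y \<otimes>\<^bsub>P\<^esub> z)
              = (bracket P x y \<otimes>\<^bsub>P\<^esub> z) \<oplus>\<^bsub>P\<^esub> (y \<otimes>\<^bsub>P\<^esub> bracket P x z)"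

locale poisson_algebra_hom =
  P?: poisson_algebra R P + Q?: poisson_algebra R Q
  for R :: "('r, 'k) ring_scheme" (structure)
    and P :: "('r, 'a, 'm) poisson_scheme" (structure)
    and Q :: "('r, 'b, 'n) poisson_scheme" (structure) +
  fixes f :: "'a \<Rightarrow> 'b"
  assumes hom_algebra: "f \<in> algebra_hom R P Q"
    and hom_bracket:
      "\<lbrakk>x \<in> carrier P; y \<in> carrier P\<rbrakk> \<Longrightarrow> f (bracket P x y) = bracket Q (f x) (f y)"


section \<open>Formal power series\<close>

text \<open>A series $\sum_i \nu^i a_i$ is the sequence of its coefficients.\<close>

definition const_series :: "('a, 'm) ring_scheme \<Rightarrow> 'a \<Rightarrow> nat \<Rightarrow> 'a"
  where "const_series A a = (\<lambda>n. if n = 0 then a else \<zero>\<^bsub>A\<^esub>)"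

definition power_series_ring :: "('a, 'm) ring_scheme \<Rightarrow> (nat \<Rightarrow> 'a) ring"
  where "power_series_ring A =
    \<lparr>carrier = UNIV \<rightarrow> carrier A,
     mult = (\<lambda>f g n. \<Oplus>\<^bsub>A\<^esub>i\<in>{..n}. f i \<otimes>\<^bsub>A\<^esub> g (n - i)),
     one = const_series A \<one>\<^bsub>A\<^esub>,
     zero = (\<lambda>n. \<zero>\<^bsub>A\<^esub>),
     add = (\<lambda>f g n. f n \<oplus>\<^bsub>A\<^esub> g n)\<rparr>"

definition power_series_algebra ::
  "('r, 'a, 'm) module_scheme \<Rightarrow> (nat \<Rightarrow> 'r, nat \<Rightarrow> 'a) module"
  where "power_series_algebra A =
    \<lparr>carrier = carrier (power_series_ring A),
     mult = mult (power_series_ring A),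
     one = one (power_series_ring A),
     zero = zero (power_series_ring A),
     add = add (power_series_ring A),
     smult = (\<lambda>r f n. \<Oplus>\<^bsub>A\<^esub>i\<in>{..n}. r i \<odot>\<^bsub>A\<^esub> f (n - i))\<rparr>"

definition nu_times :: "('a, 'm) ring_scheme \<Rightarrow> (nat \<Rightarrow> 'a) \<Rightarrow> nat \<Rightarrow> 'a"
  where "nu_times A f = (\<lambda>n. case n of 0 \<Rightarrow> \<zero>\<^bsub>A\<^esub> | Suc k \<Rightarrow> f k)"

text \<open>$\frac1\nu f$, meaningful for series $f$ without constant term.\<close>

definition nu_divide :: "(nat \<Rightarrow> 'a) \<Rightarrow> nat \<Rightarrow> 'a"
  where "nu_divide f = (\<lambda>n. f (Suc n))"

definition nu_ideal :: "('a, 'm) ring_scheme \<Rightarrow> (nat \<Rightarrow> 'a) set"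
  where "nu_ideal A = nu_times A ` carrier (power_series_ring A)"

text \<open>The map $F_0 + \nu F_1 + \nu^2 F_2 + \cdots$, each $F_i$ being applied to the
  coefficients of a series.\<close>

definition series_of_maps ::
  "('b, 'n) ring_scheme \<Rightarrow> (nat \<Rightarrow> 'a \<Rightarrow> 'b) \<Rightarrow> (nat \<Rightarrow> 'a) \<Rightarrow> nat \<Rightarrow> 'b"
  where "series_of_maps B Fs f = (\<lambda>n. \<Oplus>\<^bsub>B\<^esub>i\<in>{..n}. Fs i (f (n - i)))"


section \<open>Formal deformations\<close>

text \<open>The unit \<open>u\<close> of a deformation need not be the constant series \<open>1\<close>.\<close>

definition deformed_algebra ::
  "('r, 'a, 'm) module_scheme \<Rightarrow> ((nat \<Rightarrow> 'a) \<Rightarrow> (nat \<Rightarrow> 'a) \<Rightarrow> nat \<Rightarrow> 'a) \<Rightarrow> (nat \<Rightarrow> 'a)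
    \<Rightarrow> (nat \<Rightarrow> 'r, nat \<Rightarrow> 'a) module"
  where "deformed_algebra A star u = (power_series_algebra A)\<lparr>mult := star, one := u\<rparr>"

definition formal_deformation ::
  "('r, 'k) ring_scheme \<Rightarrow> ('r, 'a, 'm) module_scheme
    \<Rightarrow> ((nat \<Rightarrow> 'a) \<Rightarrow> (nat \<Rightarrow> 'a) \<Rightarrow> nat \<Rightarrow> 'a) \<Rightarrow> (nat \<Rightarrow> 'a) \<Rightarrow> bool"
  where "formal_deformation R A star u \<longleftrightarrow>
    assoc_algebra (power_series_ring R) (deformed_algebra A star u) \<and>
    (\<forall>a\<in>carrier A. \<forall>b\<in>carrier A.
      star (const_series A a) (const_series A b)
        \<ominus>\<^bsub>power_series_algebra A\<^esub> const_series A (a \<otimes>\<^bsub>A\<^esub> b) \<in> nu_ideal A)"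

text \<open>The coefficients $(a,b)_i$ and $\{a,b\}_i$.\<close>

definition star_coeff ::
  "('a, 'm) ring_scheme \<Rightarrow> ((nat \<Rightarrow> 'a) \<Rightarrow> (nat \<Rightarrow> 'a) \<Rightarrow> nat \<Rightarrow> 'a) \<Rightarrow> nat \<Rightarrow> 'a \<Rightarrow> 'a \<Rightarrow> 'a"
  where "star_coeff A star i a b = star (const_series A a) (const_series A b) i"

definition bracket_coeff ::
  "('r, 'a, 'm) module_scheme \<Rightarrow> ((nat \<Rightarrow> 'a) \<Rightarrow> (nat \<Rightarrow> 'a) \<Rightarrow> nat \<Rightarrow> 'a)
    \<Rightarrow> nat \<Rightarrow> 'a \<Rightarrow> 'a \<Rightarrow> 'a"
  where "bracket_coeff A star i a b =
    (star (const_series A a) (const_series A b)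
      \<ominus>\<^bsub>power_series_algebra A\<^esub> star (const_series A b) (const_series A a)) i"


section \<open>The Poisson algebras attached to a deformation\<close>

text \<open>$\mathcal H_\nu = Z(\mathcal A) + \nu\mathcal A[[\nu]]$, a Poisson algebra over $R[[\nu]]$.\<close>

definition H_nu ::
  "('r, 'a, 'm) module_scheme \<Rightarrow> ((nat \<Rightarrow> 'a) \<Rightarrow> (nat \<Rightarrow> 'a) \<Rightarrow> nat \<Rightarrow> 'a) \<Rightarrow> (nat \<Rightarrow> 'a)
    \<Rightarrow> (nat \<Rightarrow> 'r, nat \<Rightarrow> 'a) poisson"
  where "H_nu A star u =
    \<lparr>carrier = (const_series A ` center A) <+>\<^bsub>power_series_algebra A\<^esub> nu_ideal A,
     mult = star,
     one = u,
     zero = zero (power_series_algebra A),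
     add = add (power_series_algebra A),
     smult = smult (power_series_algebra A),
     bracket = (\<lambda>f g. nu_divide (commutator (deformed_algebra A star u) f g))\<rparr>"

text \<open>$\Pi(\mathcal A) = Z(\mathcal A) \times \mathcal A/Z(\mathcal A)$. Elements of
  $\mathcal A/Z(\mathcal A)$ are cosets; as in \<^const>\<open>rcoset_mult\<close>, an operation defined through
  representatives is the union of the cosets obtained from all representatives.
  The constant series \<open>1\<close> need not be the unit of $\star$, so that the unit of $\Pi(\mathcal A)$ is
  the image of \<open>u\<close>.\<close>

definition Pi_algebra ::
  "('r, 'a, 'm) module_scheme \<Rightarrow> ((nat \<Rightarrow> 'a) \<Rightarrow> (nat \<Rightarrow> 'a) \<Rightarrow> nat \<Rightarrow> 'a) \<Rightarrow> (nat \<Rightarrow> 'a)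
    \<Rightarrow> ('r, 'a \<times> 'a set) poisson"
  where "Pi_algebra A star u =
    \<lparr>carrier = center A \<times> a_rcosets\<^bsub>A\<^esub> (center A),
     mult = (\<lambda>(a, X) (b, Y).
       (a \<otimes>\<^bsub>A\<^esub> b,
        \<Union>x\<in>X. \<Union>y\<in>Y. center A +>\<^bsub>A\<^esub>
          (a \<otimes>\<^bsub>A\<^esub> y \<oplus>\<^bsub>A\<^esub> x \<otimes>\<^bsub>A\<^esub> b \<oplus>\<^bsub>A\<^esub> star_coeff A star 1 a b))),
     one = (\<one>\<^bsub>A\<^esub>, center A +>\<^bsub>A\<^esub> u 1),
     zero = (\<zero>\<^bsub>A\<^esub>, center A),
     add = (\<lambda>(a, X) (b, Y). (a \<oplus>\<^bsub>A\<^esub> b, X <+>\<^bsub>A\<^esub> Y)),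
     smult = (\<lambda>r (a, X). (r \<odot>\<^bsub>A\<^esub> a, \<Union>x\<in>X. center A +>\<^bsub>A\<^esub> (r \<odot>\<^bsub>A\<^esub> x))),
     bracket = (\<lambda>(a, X) (b, Y).
       (bracket_coeff A star 1 a b,
        \<Union>x\<in>X. \<Union>y\<in>Y. center A +>\<^bsub>A\<^esub>
          (bracket_coeff A star 2 a b \<oplus>\<^bsub>A\<^esub> bracket_coeff A star 1 x b
            \<oplus>\<^bsub>A\<^esub> bracket_coeff A star 1 a y \<oplus>\<^bsub>A\<^esub> commutator A x y)))\<rparr>"

definition p_Pi :: "('a, 'm) ring_scheme \<Rightarrow> (nat \<Rightarrow> 'a) \<Rightarrow> 'a \<times> 'a set"
  where "p_Pi A f = (f 0, center A +>\<^bsub>A\<^esub> f 1)"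

text \<open>The reduced Poisson algebra, the projection from $\Pi(\mathcal A)$ onto it being \<^const>\<open>fst\<close>.\<close>

definition reduced_algebra ::
  "('r, 'a, 'm) module_scheme \<Rightarrow> ((nat \<Rightarrow> 'a) \<Rightarrow> (nat \<Rightarrow> 'a) \<Rightarrow> nat \<Rightarrow> 'a) \<Rightarrow> ('r, 'a) poisson"
  where "reduced_algebra A star =
    \<lparr>carrier = center A, mult = mult A, one = one A, zero = zero A, add = add A,
     smult = smult A, bracket = bracket_coeff A star 1\<rparr>"

text \<open>\<open>g\<close> is a map \<open>Y \<rightarrow> Y'\<close> induced by \<open>f\<close> along the projections \<open>p\<close> from \<open>X\<close> to \<open>Y\<close>
  and \<open>p'\<close> to \<open>Y'\<close>. Extensionality outside \<open>Y\<close> makes equality of such \<open>g\<close> equality as maps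
  on \<open>Y\<close>.\<close>

definition induced_map ::
  "'x set \<Rightarrow> ('x \<Rightarrow> 'y) \<Rightarrow> ('z \<Rightarrow> 'w) \<Rightarrow> 'y set \<Rightarrow> 'w set \<Rightarrow> ('x \<Rightarrow> 'z) \<Rightarrow> ('y \<Rightarrow> 'w) \<Rightarrow> bool"
  where "induced_map X p p' Y Y' f g \<longleftrightarrow>
    g \<in> Y \<rightarrow>\<^sub>E Y' \<and> (\<forall>x\<in>X. g (p x) = p' (f x))"

end

theory Submission
  imports Defs
begin

text \<open>The element \<open>\<nu>\<close> is central and cancellable in the deformed algebra, and \<open>\<nu> {f, g} = [f, g]\<close>
  on \<open>H\<close>. Hence each Poisson identity on \<open>H\<close>, and compatibility of \<open>F\<close> with the brackets, is
  a commutator identity with a power of \<open>\<nu>\<close> cancelled. The formulas for the operations of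
  \<open>\<Pi>(A)\<close> and \<open>Z(A)\<close> say that \<open>H \<rightarrow> \<Pi>(A) \<rightarrow> Z(A)\<close> are surjections respecting all operations, so
  both the Poisson axioms and the morphism property descend along them. The map \<open>F\<close> descends
  because \<open>(F f)\<^sub>0 = F\<^sub>0 f\<^sub>0\<close> and \<open>(F f)\<^sub>1 = F\<^sub>1 f\<^sub>0 + F\<^sub>0 f\<^sub>1\<close>, where \<open>F\<^sub>0\<close> preserves the centers.\<close>

section \<open>Commutators and the center\<close>

lemma (in abelian_group) add_minus_add_cancel_right:
  assumes "x \<in> carrier G" "y \<in> carrier G" "z \<in> carrier G"
  shows "(x \<oplus> z) \<ominus> (y \<oplus> z) = x \<ominus> y"
  using assms a_comm[of y z] by (simp add: a_minus_def minus_add a_assoc r_neg2)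

context ring
begin

lemma commutator_closed [simp, intro]:
  "\<lbrakk>x \<in> carrier R; y \<in> carrier R\<rbrakk> \<Longrightarrow> commutator R x y \<in> carrier R"
  by (simp add: commutator_def)

lemma commutator_self: "x \<in> carrier R \<Longrightarrow> commutator R x x = \<zero>"
  unfolding commutator_def by algebra

lemma commutator_add_left:
  "\<lbrakk>x \<in> carrier R; y \<in> carrier R; z \<in> carrier R\<rbrakk>
    \<Longrightarrow> commutator R (x \<oplus> y) z = commutator R x z \<oplus> commutator R y z"
  unfolding commutator_def by algebra

lemma commutator_add_right:
  "\<lbrakk>x \<in> carrier R; y \<in> carrier R; z \<in> carrier R\<rbrakk>
    \<Longrightarrow> commutator R x (y \<oplus> z) = commutator R x y \<oplus> commutator R x z"
  unfolding commutator_def by algebra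

lemma commutator_mult_right:
  "\<lbrakk>x \<in> carrier R; y \<in> carrier R; z \<in> carrier R\<rbrakk>
    \<Longrightarrow> commutator R x (y \<otimes> z) = commutator R x y \<otimes> z \<oplus> y \<otimes> commutator R x z"
  unfolding commutator_def by algebra

lemma commutator_jacobi:
  "\<lbrakk>x \<in> carrier R; y \<in> carrier R; z \<in> carrier R\<rbrakk>
    \<Longrightarrow> commutator R x (commutator R y z) \<oplus> commutator R y (commutator R z x)
          \<oplus> commutator R z (commutator R x y) = \<zero>"
  unfolding commutator_def by algebra

text \<open>The Jacobi identity, arranged so that the nested commutator on the left is a difference
  of two iterated commutators. In this form it controls how a bracket of two elements of
  \<open>H\<close> commutes with a third element.\<close>

lemma commutator_commutator_left:
  "\<lbrakk>x \<in> carrier R; y \<in> carrier R; z \<in> carrier R\<rbrakk>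
    \<Longrightarrow> commutator R (commutator R x y) z
          = commutator R x (commutator R y z) \<ominus> commutator R y (commutator R x z)"
  unfolding commutator_def by algebra

lemma commutator_eq_zero_iff:
  "\<lbrakk>x \<in> carrier R; y \<in> carrier R\<rbrakk> \<Longrightarrow> commutator R x y = \<zero> \<longleftrightarrow> x \<otimes> y = y \<otimes> x"
  unfolding commutator_def by (metis a_minus_def add.inv_equality add.inv_closed add.r_inv
      m_closed minus_minus)

lemma center_subset: "center R \<subseteq> carrier R"
  by (auto simp: center_def)

lemma center_closed: "z \<in> center R \<Longrightarrow> z \<in> carrier R"
  by (simp add: center_def)

lemma center_commute: "\<lbrakk>z \<in> center R; x \<in> carrier R\<rbrakk> \<Longrightarrow> z \<otimes> x = x \<otimes> z"
  by (simp add: center_def)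

lemma centerI:
  "\<lbrakk>z \<in> carrier R; \<And>x. x \<in> carrier R \<Longrightarrow> commutator R z x = \<zero>\<rbrakk> \<Longrightarrow> z \<in> center R"
  by (simp add: center_def commutator_eq_zero_iff)

lemma commutator_center_left: "\<lbrakk>z \<in> center R; x \<in> carrier R\<rbrakk> \<Longrightarrow> commutator R z x = \<zero>"
  by (simp add: commutator_eq_zero_iff center_closed center_commute)

lemma commutator_center_right: "\<lbrakk>z \<in> center R; x \<in> carrier R\<rbrakk> \<Longrightarrow> commutator R x z = \<zero>"
  by (simp add: commutator_eq_zero_iff center_closed center_commute)

lemma center_zero: "\<zero> \<in> center R"
  by (simp add: center_def)

lemma center_one: "\<one> \<in> center R"
  by (simp add: center_def)

lemma center_add: "\<lbrakk>x \<in> center R; y \<in> center R\<rbrakk> \<Longrightarrow> x \<oplus> y \<in> center R"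
  by (simp add: center_def l_distr r_distr)

lemma center_a_inv: "x \<in> center R \<Longrightarrow> \<ominus> x \<in> center R"
  by (simp add: center_def l_minus r_minus)

lemma center_mult:
  assumes xy: "x \<in> center R" "y \<in> center R"
  shows "x \<otimes> y \<in> center R"
proof -
  have "x \<otimes> y \<otimes> c = c \<otimes> (x \<otimes> y)" if "c \<in> carrier R" for c
  proof -
    note [simp] = that xy[THEN center_closed]
    have "x \<otimes> y \<otimes> c = x \<otimes> c \<otimes> y"
      using xy(2) by (simp add: m_assoc center_commute)
    also have "\<dots> = c \<otimes> (x \<otimes> y)"
      using xy(1) by (simp add: center_commute flip: m_assoc)
    finally show ?thesis .
  qed
  then show ?thesis
    using xy[THEN center_closed] unfolding center_def by blast
qed

section \<open>Cosets of the center\<close>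

lemma additive_subgroup_center: "additive_subgroup (center R) R"
  unfolding additive_subgroup_def
  using center_zero
  by (intro add.subgroupI center_subset center_add center_a_inv) blast+

lemma abelian_subgroup_center: "abelian_subgroup (center R) R"
  by (intro abelian_subgroupI3 additive_subgroup_center is_abelian_group)

lemma center_coset_add_left:
  assumes "z \<in> center R" "x \<in> carrier R"
  shows "center R +> (z \<oplus> x) = center R +> x"
proof -
  have "z \<oplus> x \<in> center R +> x"
    using assms by (auto simp: a_r_coset_def')
  with assms show ?thesis
    by (metis a_repr_independence additive_subgroup.a_subgroup additive_subgroup_center)
qed

text \<open>The third assumption is independence of the representative modulo the center. Hence all
  cosets in the union coincide. This lemma and its binary version turn the unions that define the
  operations of \<open>Pi_algebra\<close> into single cosets of chosen representatives.\<close>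

lemma UN_center_coset:
  assumes "x \<in> carrier R" "f x \<in> carrier R"
    and "\<And>z. z \<in> center R \<Longrightarrow> \<exists>w\<in>center R. f (z \<oplus> x) = w \<oplus> f x"
  shows "(\<Union>x'\<in>center R +> x. center R +> f x') = center R +> f x"
proof -
  have eq: "center R +> f x' = center R +> f x" if "x' \<in> center R +> x" for x'
  proof -
    from that obtain z where "z \<in> center R" "x' = z \<oplus> x"
      by (auto simp: a_r_coset_def')
    with assms(3) show ?thesis
      by (metis center_coset_add_left assms(2))
  qed
  \<comment> \<open>The representative \<open>x\<close> lies in its own coset, so the union is not
    empty and its common value is attained.\<close>
  have "\<zero> \<oplus> x \<in> center R +> x"
    using center_zero by (auto simp: a_r_coset_def')
  with eq show ?thesis by blast
qed

lemma UN_center_coset2: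
  assumes "x \<in> carrier R" "y \<in> carrier R" "f x y \<in> carrier R"
    and "\<And>z z'. \<lbrakk>z \<in> center R; z' \<in> center R\<rbrakk> \<Longrightarrow> \<exists>w\<in>center R. f (z \<oplus> x) (z' \<oplus> y) = w \<oplus> f x y"
  shows "(\<Union>x'\<in>center R +> x. \<Union>y'\<in>center R +> y. center R +> f x' y') = center R +> f x y"
proof -
  have eq: "center R +> f x' y' = center R +> f x y"
    if "x' \<in> center R +> x" "y' \<in> center R +> y" for x' y'
  proof -
    from that obtain z z' where "z \<in> center R" "x' = z \<oplus> x" "z' \<in> center R" "y' = z' \<oplus> y"
      by (auto simp: a_r_coset_def')
    with assms(4) show ?thesis
      by (metis center_coset_add_left assms(3))
  qed
  have "\<zero> \<oplus> x \<in> center R +> x" "\<zero> \<oplus> y \<in> center R +> y"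
    using center_zero by (auto simp: a_r_coset_def')
  with eq show ?thesis by blast
qed

end

text \<open>Evaluates the convolution sums in which one factor has a single nonzero coefficient,
  such as a constant series or \<nu>.\<close>

lemma (in abelian_monoid) finsum_single:
  assumes "finite I" "i \<in> I" "f i \<in> carrier G" "\<And>j. \<lbrakk>j \<in> I; j \<noteq> i\<rbrakk> \<Longrightarrow> f j = \<zero>"
  shows "finsum G f I = f i"
proof -
  have "finsum G f I = finsum G (\<lambda>j. if j = i then f i else \<zero>) I"
    using assms by (intro finsum_cong') auto
  also have "\<dots> = f i"
    using add.finprod_singleton_swap[of i I "\<lambda>_. f i"] assms by simp
  finally show ?thesis .
qed

section \<open>Commutators, the center and scalars\<close>

context assoc_algebra
begin

lemma smult_commutator_left:
  "\<lbrakk>r \<in> carrier R; x \<in> carrier A; y \<in> carrier A\<rbrakk>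
    \<Longrightarrow> commutator A (r \<odot>\<^bsub>A\<^esub> x) y = r \<odot>\<^bsub>A\<^esub> commutator A x y"
  by (simp add: commutator_def smult_mult_left smult_mult_right a_minus_def smult_r_distr
      smult_r_minus)

lemma smult_commutator_right:
  "\<lbrakk>r \<in> carrier R; x \<in> carrier A; y \<in> carrier A\<rbrakk>
    \<Longrightarrow> commutator A x (r \<odot>\<^bsub>A\<^esub> y) = r \<odot>\<^bsub>A\<^esub> commutator A x y"
  by (simp add: commutator_def smult_mult_left smult_mult_right a_minus_def smult_r_distr
      smult_r_minus)

lemma smult_center: "\<lbrakk>r \<in> carrier R; x \<in> center A\<rbrakk> \<Longrightarrow> r \<odot>\<^bsub>A\<^esub> x \<in> center A"
  by (simp add: center_def smult_mult_left smult_mult_right)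

end

section \<open>Transport of Poisson structures along surjections\<close>

text \<open>The scalars may change along \<rho>: from \<open>H\<close> to \<open>Pi_algebra\<close>
  they go from R[[\<nu>]] to R, which is embedded as the constants, and from
  \<open>Pi_algebra\<close> to the reduced algebra \<rho> is the identity. The Poisson laws of
  \<open>Q\<close> are a conclusion, since its operations are first given only by formulas.\<close>

locale poisson_projection = P: poisson_algebra S P + R: cring R
  for S :: "('s, 'j) ring_scheme" and P :: "('s, 'a, 'm) poisson_scheme"
    and R :: "('r, 'k) ring_scheme" and Q :: "('r, 'b, 'n) poisson_scheme"
    and \<rho> :: "'r \<Rightarrow> 's" and \<phi> :: "'a \<Rightarrow> 'b" +
  assumes scalar_hom: "\<rho> \<in> ring_hom R S"
    and image_carrier: "carrier Q = \<phi> ` carrier P"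
    and proj_add: "\<lbrakk>x \<in> carrier P; y \<in> carrier P\<rbrakk> \<Longrightarrow> \<phi> x \<oplus>\<^bsub>Q\<^esub> \<phi> y = \<phi> (x \<oplus>\<^bsub>P\<^esub> y)"
    and proj_mult: "\<lbrakk>x \<in> carrier P; y \<in> carrier P\<rbrakk> \<Longrightarrow> \<phi> x \<otimes>\<^bsub>Q\<^esub> \<phi> y = \<phi> (x \<otimes>\<^bsub>P\<^esub> y)"
    and proj_bracket:
      "\<lbrakk>x \<in> carrier P; y \<in> carrier P\<rbrakk> \<Longrightarrow> bracket Q (\<phi> x) (\<phi> y) = \<phi> (bracket P x y)"
    and proj_smult:
      "\<lbrakk>r \<in> carrier R; x \<in> carrier P\<rbrakk> \<Longrightarrow> r \<odot>\<^bsub>Q\<^esub> \<phi> x = \<phi> (\<rho> r \<odot>\<^bsub>P\<^esub> x)"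
    and proj_zero: "\<zero>\<^bsub>Q\<^esub> = \<phi> \<zero>\<^bsub>P\<^esub>"
    and proj_one: "\<one>\<^bsub>Q\<^esub> = \<phi> \<one>\<^bsub>P\<^esub>"
begin

lemmas proj = proj_add proj_mult proj_bracket proj_smult proj_zero proj_one

lemma scalar_closed: "r \<in> carrier R \<Longrightarrow> \<rho> r \<in> carrier S"
  using scalar_hom by (rule ring_hom_closed)

text \<open>Every element of \<open>Q\<close> is an image, so each equational law is the law of
  \<open>P\<close> with \<phi> applied to both sides. Opposites come from the images of opposites in
  \<open>P\<close>.\<close>

lemma poisson_algebra_image: "poisson_algebra R Q"
proof -
  note [simp] = proj image_carrier scalar_closed P.bracket_closed
  have ab: "abelian_group Q"
  proof (rule abelian_groupI)
    fix x assume "x \<in> carrier Q"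
    then obtain p where p: "p \<in> carrier P" "x = \<phi> p" by auto
    then show "\<exists>y\<in>carrier Q. y \<oplus>\<^bsub>Q\<^esub> x = \<zero>\<^bsub>Q\<^esub>"
      by (auto intro!: bexI[of _ "\<ominus>\<^bsub>P\<^esub> p"] simp: P.l_neg)
  qed (auto simp: P.a_assoc P.a_comm P.a_lcomm)
  have ring: "ring Q"
    by (intro ringI ab monoidI)
      (auto simp: P.m_assoc P.l_distr P.r_distr)
  have mod: "module R Q"
    by (intro moduleI ab R.is_cring)
      (auto simp: P.smult_l_distr P.smult_r_distr P.smult_assoc1
        ring_hom_add[OF scalar_hom] ring_hom_mult[OF scalar_hom] ring_hom_one[OF scalar_hom])
  have alg: "assoc_algebra R Q"
    by (intro assoc_algebra.intro mod ring assoc_algebra_axioms.intro)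
      (auto simp: P.smult_mult_left P.smult_mult_right)
  show ?thesis
    by (intro poisson_algebra.intro alg poisson_algebra_axioms.intro)
      (auto simp: P.bracket_add_left P.bracket_add_right P.bracket_smult_left
        P.bracket_smult_right P.bracket_self P.jacobi P.leibniz)
qed

end

text \<open>By surjectivity all arguments have the form \<phi> x, where \<open>G\<close> is
  determined by \<open>F\<close>. Each compatibility of \<open>F\<close> is thus pushed forward by
  \<phi>'. A scalar r acts through \<rho> r on both sides, so linearity of \<open>F\<close> over
  \<open>S\<close> gives linearity of \<open>G\<close> over \<open>R\<close>.\<close>

lemma poisson_algebra_hom_induced:
  assumes "poisson_projection S P R Q \<rho> \<phi>" and "poisson_projection S P' R Q' \<rho> \<phi>'"
    and "poisson_algebra_hom S P P' F"
    and "induced_map (carrier P) \<phi> \<phi>' (carrier Q) (carrier Q') F G"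
  shows "poisson_algebra_hom R Q Q' G"
proof -
  interpret pr: poisson_projection S P R Q \<rho> \<phi> by fact
  interpret pr': poisson_projection S P' R Q' \<rho> \<phi>' by fact
  interpret h: poisson_algebra_hom S P P' F by fact
  have G: "G (\<phi> x) = \<phi>' (F x)" if "x \<in> carrier P" for x
    using assms(4) that by (auto simp: induced_map_def)
  have Gc: "G \<in> carrier Q \<rightarrow> carrier Q'"
    using assms(4) by (auto simp: induced_map_def)
  have F: "F \<in> ring_hom P P'" "F \<in> linear_maps S P P'"
    using h.hom_algebra by (auto simp: algebra_hom_def)
  have Fs: "F (r \<odot>\<^bsub>P\<^esub> x) = r \<odot>\<^bsub>P'\<^esub> F x" if "r \<in> carrier S" "x \<in> carrier P" for r x
    using F(2) that by (auto simp: linear_maps_def)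
  note [simp] = G Fs ring_hom_closed[OF F(1)] ring_hom_add[OF F(1)] ring_hom_mult[OF F(1)]
    ring_hom_one[OF F(1)] pr.proj pr'.proj pr.scalar_closed pr.P.bracket_closed h.hom_bracket
  have "G \<in> ring_hom Q Q'"
    using Gc by (intro ring_hom_memI) (auto simp: pr.image_carrier)
  moreover have "G \<in> linear_maps R Q Q'"
    using Gc by (auto simp: linear_maps_def pr.image_carrier)
  moreover have "G (bracket Q x y) = bracket Q' (G x) (G y)"
    if "x \<in> carrier Q" "y \<in> carrier Q" for x y
    using that by (auto simp: pr.image_carrier)
  ultimately show ?thesis
    using pr.poisson_algebra_image pr'.poisson_algebra_image
    by (auto intro!: poisson_algebra_hom.intro poisson_algebra_hom_axioms.intro
        simp: algebra_hom_def)
qed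

lemma ex1_induced_map:
  assumes "Y = p ` X" and "\<And>x. x \<in> X \<Longrightarrow> p' (f x) \<in> Y'"
    and "\<And>x y. \<lbrakk>x \<in> X; y \<in> X; p x = p y\<rbrakk> \<Longrightarrow> p' (f x) = p' (f y)"
  shows "\<exists>!g. induced_map X p p' Y Y' f g"
proof -
  \<comment> \<open>Choose any preimage under \<open>p\<close>; the last assumption makes the choice
    irrelevant. Uniqueness comes from surjectivity onto \<open>Y\<close> and extensionality outside
    it.\<close>
  define g where "g = (\<lambda>y\<in>Y. p' (f (inv_into X p y)))"
  have g: "g (p x) = p' (f x)" if "x \<in> X" for x
    using that assms(3)[of "inv_into X p (p x)" x]
    by (simp add: g_def assms(1) inv_into_into f_inv_into_f)
  show ?thesis
  proof
    show "induced_map X p p' Y Y' f g"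
      using assms(1,2) g by (auto simp: induced_map_def g_def)
  next
    fix h assume h: "induced_map X p p' Y Y' f h"
    show "h = g"
      by (rule extensionalityI[of _ Y])
        (use h g in \<open>auto simp: induced_map_def g_def assms(1) PiE_def\<close>)
  qed
qed

section \<open>Coefficients of a deformed product\<close>

text \<open>The variable \<nu> is encoded as a scalar in R[[\<nu>]], not as a series over the
  algebra. Bilinearity of the product and linearity of \<open>F\<close> then move it through both,
  and the same \<nu> serves both deformations.\<close>

definition nu_series :: "('r, 'k) ring_scheme \<Rightarrow> nat \<Rightarrow> 'r"
  where "nu_series R = nu_times R (const_series R \<one>\<^bsub>R\<^esub>)"

lemma power_series_ring_simps:
  "carrier (power_series_ring A) = UNIV \<rightarrow> carrier A"
  "\<zero>\<^bsub>power_series_ring A\<^esub> = (\<lambda>n. \<zero>\<^bsub>A\<^esub>)"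
  "\<one>\<^bsub>power_series_ring A\<^esub> = const_series A \<one>\<^bsub>A\<^esub>"
  "f \<oplus>\<^bsub>power_series_ring A\<^esub> g = (\<lambda>n. f n \<oplus>\<^bsub>A\<^esub> g n)"
  by (simp_all add: power_series_ring_def)

context ring
begin

lemma const_series_closed [simp]: "a \<in> carrier R \<Longrightarrow> const_series R a n \<in> carrier R"
  by (simp add: const_series_def)

lemma nu_times_closed [simp]: "(\<And>n. f n \<in> carrier R) \<Longrightarrow> nu_times R f n \<in> carrier R"
  by (simp add: nu_times_def split: nat.split)

lemma const_series_ring_hom: "const_series R \<in> ring_hom R (power_series_ring R)"
proof (intro ring_hom_memI)
  fix a b assume ab: "a \<in> carrier R" "b \<in> carrier R"
  show "const_series R (a \<otimes> b) = const_series R a \<otimes>\<^bsub>power_series_ring R\<^esub> const_series R b"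
  proof
    fix n
    show "const_series R (a \<otimes> b) n
            = (const_series R a \<otimes>\<^bsub>power_series_ring R\<^esub> const_series R b) n"
      using ab finsum_single[of "{..n}" 0 "\<lambda>i. const_series R a i \<otimes> const_series R b (n - i)"]
      by (auto simp: power_series_ring_def const_series_def)
  qed
qed (auto simp: const_series_def power_series_ring_simps)

end

lemma nu_times_simps [simp]:
  "nu_times A f 0 = \<zero>\<^bsub>A\<^esub>" "nu_times A f (Suc n) = f n"
  by (simp_all add: nu_times_def)

lemma const_series_simps [simp]:
  "const_series A a 0 = a" "const_series A a (Suc n) = \<zero>\<^bsub>A\<^esub>"
  by (simp_all add: const_series_def)

text \<open>Subtraction depends only on the additive structure, which a deformation keeps. The
  definitions subtract in the undeformed algebra, while the ring laws at hand are those of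
  \<open>D\<close>.\<close>

lemma a_minus_deformed_algebra:
  "a_minus (power_series_algebra A) = a_minus (deformed_algebra A star u)"
  by (simp add: fun_eq_iff a_minus_def a_inv_def m_inv_def deformed_algebra_def)

locale deformation = assoc_algebra R A
  for R :: "('r, 'k) ring_scheme" (structure) and A :: "('r, 'a, 'm) module_scheme" (structure) +
  fixes star :: "(nat \<Rightarrow> 'a) \<Rightarrow> (nat \<Rightarrow> 'a) \<Rightarrow> nat \<Rightarrow> 'a" and u :: "nat \<Rightarrow> 'a"
  assumes deformation: "formal_deformation R A star u"
begin

abbreviation "S \<equiv> power_series_ring R"
abbreviation "D \<equiv> deformed_algebra A star u"
abbreviation "H \<equiv> H_nu A star u"
abbreviation "c \<equiv> const_series A"
abbreviation "\<nu> \<equiv> nu_series R"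

sublocale D: assoc_algebra S D
  using deformation by (simp add: formal_deformation_def)

lemma carrier_D: "carrier D = UNIV \<rightarrow> carrier A"
  by (simp add: deformed_algebra_def power_series_algebra_def power_series_ring_simps)

lemma mult_D: "f \<otimes>\<^bsub>D\<^esub> g = star f g"
  by (simp add: deformed_algebra_def)

lemma one_D: "\<one>\<^bsub>D\<^esub> = u"
  by (simp add: deformed_algebra_def)

lemma zero_D [simp]: "\<zero>\<^bsub>D\<^esub> = (\<lambda>n. \<zero>\<^bsub>A\<^esub>)"
  by (simp add: deformed_algebra_def power_series_algebra_def power_series_ring_simps)

lemma add_D [simp]: "f \<oplus>\<^bsub>D\<^esub> g = (\<lambda>n. f n \<oplus>\<^bsub>A\<^esub> g n)"
  by (simp add: deformed_algebra_def power_series_algebra_def power_series_ring_simps)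

lemma smult_D: "r \<odot>\<^bsub>D\<^esub> f = (\<lambda>n. \<Oplus>\<^bsub>A\<^esub>i\<in>{..n}. r i \<odot>\<^bsub>A\<^esub> f (n - i))"
  by (simp add: deformed_algebra_def power_series_algebra_def power_series_ring_simps)

lemma D_mem: "f \<in> carrier D \<longleftrightarrow> (\<forall>n. f n \<in> carrier A)"
  by (auto simp: carrier_D)

lemma coeff_closed [simp]: "f \<in> carrier D \<Longrightarrow> f n \<in> carrier A"
  by (simp add: D_mem)

lemma a_inv_D [simp]:
  assumes "f \<in> carrier D"
  shows "\<ominus>\<^bsub>D\<^esub> f = (\<lambda>n. \<ominus>\<^bsub>A\<^esub> f n)"
  by (rule D.minus_equality) (use assms in \<open>auto simp: D_mem l_neg\<close>)

lemma a_minus_D [simp]: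
  "g \<in> carrier D \<Longrightarrow> f \<ominus>\<^bsub>D\<^esub> g = (\<lambda>n. f n \<ominus>\<^bsub>A\<^esub> g n)"
  by (simp add: a_minus_def)

lemma const_closed [simp]: "a \<in> carrier A \<Longrightarrow> c a \<in> carrier D"
  by (simp add: D_mem)

lemma nu_closed [simp]: "\<nu> \<in> carrier S"
  by (simp add: nu_series_def power_series_ring_simps)

lemma nu_times_D_closed [simp]: "f \<in> carrier D \<Longrightarrow> nu_times A f \<in> carrier D"
  by (simp add: D_mem)

lemma nu_divide_closed [simp]: "f \<in> carrier D \<Longrightarrow> nu_divide f \<in> carrier D"
  by (simp add: D_mem nu_divide_def)

lemma nu_smult:
  assumes f: "f \<in> carrier D"
  shows "\<nu> \<odot>\<^bsub>D\<^esub> f = nu_times A f"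
proof
  fix n
  show "(\<nu> \<odot>\<^bsub>D\<^esub> f) n = nu_times A f n"
  proof (cases n)
    case 0
    with f show ?thesis by (simp add: smult_D nu_series_def)
  next
    case (Suc k)
    \<comment> \<open>Only the coefficient of \<nu> at index 1 survives, so the convolution is a
      shift by one place.\<close>
    have "\<nu> j \<odot>\<^bsub>A\<^esub> f (n - j) = \<zero>\<^bsub>A\<^esub>" if "j \<noteq> 1" for j
      using that f by (cases j; cases "j - 1") (auto simp: nu_series_def const_series_def)
    then show ?thesis
      using Suc f finsum_single[of "{..n}" 1 "\<lambda>i. \<nu> i \<odot>\<^bsub>A\<^esub> f (n - i)"]
      by (simp add: smult_D nu_series_def)
  qed
qed

lemma const_smult:
  assumes "r \<in> carrier R" "f \<in> carrier D"
  shows "const_series R r \<odot>\<^bsub>D\<^esub> f = (\<lambda>n. r \<odot>\<^bsub>A\<^esub> f n)"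
proof
  fix n
  show "(const_series R r \<odot>\<^bsub>D\<^esub> f) n = r \<odot>\<^bsub>A\<^esub> f n"
    using assms finsum_single[of "{..n}" 0 "\<lambda>i. const_series R r i \<odot>\<^bsub>A\<^esub> f (n - i)"]
    by (simp add: smult_D const_series_def)
qed

text \<open>Multiplication by \<nu> shifts coefficients, so coefficient n of a series is read off at
  index n + 1.\<close>

lemma nu_cancel:
  assumes "f \<in> carrier D" "g \<in> carrier D" "\<nu> \<odot>\<^bsub>D\<^esub> f = \<nu> \<odot>\<^bsub>D\<^esub> g"
  shows "f = g"
proof
  fix n
  show "f n = g n"
    using fun_cong[OF assms(3), of "Suc n"] assms(1,2) by (simp add: nu_smult)
qed

section \<open>Splitting off constant terms, and the low coefficients of products\<close>

lemma nu_times_divide: "f 0 = \<zero>\<^bsub>A\<^esub> \<Longrightarrow> nu_times A (nu_divide f) = f"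
  by (auto simp: nu_times_def nu_divide_def split: nat.split)

lemma nu_divide_const [simp]: "nu_divide (c a) = \<zero>\<^bsub>D\<^esub>"
  by (simp add: nu_divide_def)

lemma series_split:
  assumes "f \<in> carrier D"
  shows "f = c (f 0) \<oplus>\<^bsub>D\<^esub> \<nu> \<odot>\<^bsub>D\<^esub> nu_divide f"
proof
  fix n
  show "f n = (c (f 0) \<oplus>\<^bsub>D\<^esub> \<nu> \<odot>\<^bsub>D\<^esub> nu_divide f) n"
    using assms by (cases n) (simp_all add: nu_smult, simp add: nu_divide_def)
qed

text \<open>Bilinearity over R[[\<nu>]] applied to \<open>series_split\<close>, first for
  \<open>g\<close> and then for \<open>f\<close> in the term with the constant \<open>g 0\<close>.
  Both remaining products carry a factor \<nu>, so a coefficient of the product reduces to constants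
  and to coefficients of lower index.\<close>

lemma mult_split:
  assumes f: "f \<in> carrier D" and g: "g \<in> carrier D"
  shows "f \<otimes>\<^bsub>D\<^esub> g = c (f 0) \<otimes>\<^bsub>D\<^esub> c (g 0) \<oplus>\<^bsub>D\<^esub> nu_times A (nu_divide f \<otimes>\<^bsub>D\<^esub> c (g 0))
    \<oplus>\<^bsub>D\<^esub> nu_times A (f \<otimes>\<^bsub>D\<^esub> nu_divide g)"
proof -
  have "f \<otimes>\<^bsub>D\<^esub> g = f \<otimes>\<^bsub>D\<^esub> c (g 0) \<oplus>\<^bsub>D\<^esub> f \<otimes>\<^bsub>D\<^esub> (\<nu> \<odot>\<^bsub>D\<^esub> nu_divide g)"
    using f g series_split[OF g] D.r_distr[of "c (g 0)" "\<nu> \<odot>\<^bsub>D\<^esub> nu_divide g" f]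
    by (simp del: add_D)
  also have "f \<otimes>\<^bsub>D\<^esub> c (g 0) = c (f 0) \<otimes>\<^bsub>D\<^esub> c (g 0) \<oplus>\<^bsub>D\<^esub> (\<nu> \<odot>\<^bsub>D\<^esub> nu_divide f) \<otimes>\<^bsub>D\<^esub> c (g 0)"
    using f g series_split[OF f] D.l_distr[of "c (f 0)" "\<nu> \<odot>\<^bsub>D\<^esub> nu_divide f" "c (g 0)"]
    by (simp del: add_D)
  finally show ?thesis
    using f g D.smult_mult_left[of \<nu>] D.smult_mult_right[of \<nu>]
    by (simp add: nu_smult del: add_D)
qed

lemma mult_const_0:
  assumes "a \<in> carrier A" "b \<in> carrier A"
  shows "(c a \<otimes>\<^bsub>D\<^esub> c b) 0 = a \<otimes>\<^bsub>A\<^esub> b"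
proof -
  have "c a \<otimes>\<^bsub>D\<^esub> c b \<ominus>\<^bsub>D\<^esub> c (a \<otimes>\<^bsub>A\<^esub> b) \<in> nu_ideal A"
    using deformation assms
    by (simp add: formal_deformation_def mult_D a_minus_deformed_algebra[of _ star u] del: a_minus_D)
  then have "(c a \<otimes>\<^bsub>D\<^esub> c b \<ominus>\<^bsub>D\<^esub> c (a \<otimes>\<^bsub>A\<^esub> b)) 0 = \<zero>\<^bsub>A\<^esub>"
    by (auto simp: nu_ideal_def simp del: a_minus_D)
  then have "(c a \<otimes>\<^bsub>D\<^esub> c b) 0 \<ominus>\<^bsub>A\<^esub> a \<otimes>\<^bsub>A\<^esub> b = \<zero>\<^bsub>A\<^esub>"
    using assms by simp
  then have "(c a \<otimes>\<^bsub>D\<^esub> c b) 0 \<ominus>\<^bsub>A\<^esub> a \<otimes>\<^bsub>A\<^esub> b \<oplus>\<^bsub>A\<^esub> a \<otimes>\<^bsub>A\<^esub> b = a \<otimes>\<^bsub>A\<^esub> b"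
    using assms by simp
  then show ?thesis
    using assms by (simp add: a_minus_def a_assoc l_neg)
qed

lemma mult_0:
  "\<lbrakk>f \<in> carrier D; g \<in> carrier D\<rbrakk> \<Longrightarrow> (f \<otimes>\<^bsub>D\<^esub> g) 0 = f 0 \<otimes>\<^bsub>A\<^esub> g 0"
  by (subst mult_split) (simp_all add: mult_const_0)

lemma mult_Suc:
  "\<lbrakk>f \<in> carrier D; g \<in> carrier D\<rbrakk> \<Longrightarrow> (f \<otimes>\<^bsub>D\<^esub> g) (Suc n)
    = star_coeff A star (Suc n) (f 0) (g 0) \<oplus>\<^bsub>A\<^esub> (nu_divide f \<otimes>\<^bsub>D\<^esub> c (g 0)) n
      \<oplus>\<^bsub>A\<^esub> (f \<otimes>\<^bsub>D\<^esub> nu_divide g) n"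
  by (subst mult_split) (simp_all add: star_coeff_def mult_D)

lemma star_coeff_closed [simp]:
  "\<lbrakk>a \<in> carrier A; b \<in> carrier A\<rbrakk> \<Longrightarrow> star_coeff A star i a b \<in> carrier A"
  using D.m_closed[of "c a" "c b"] by (simp add: star_coeff_def mult_D)

lemma mult_1:
  assumes "f \<in> carrier D" "g \<in> carrier D"
  shows "(f \<otimes>\<^bsub>D\<^esub> g) 1 = f 0 \<otimes>\<^bsub>A\<^esub> g 1 \<oplus>\<^bsub>A\<^esub> f 1 \<otimes>\<^bsub>A\<^esub> g 0 \<oplus>\<^bsub>A\<^esub> star_coeff A star 1 (f 0) (g 0)"
  using mult_Suc[OF assms, of 0] assms
  by (simp add: mult_0 nu_divide_def[of f] nu_divide_def[of g] D_mem a_ac)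

text \<open>The last two summands are grouped because, for central \<open>f 0\<close> and
  \<open>g 0\<close>, their sum is symmetric in \<open>f\<close> and \<open>g\<close> and drops out
  of the commutator.\<close>

lemma mult_2:
  assumes "f \<in> carrier D" "g \<in> carrier D"
  shows "(f \<otimes>\<^bsub>D\<^esub> g) 2 = star_coeff A star 2 (f 0) (g 0) \<oplus>\<^bsub>A\<^esub> star_coeff A star 1 (f 1) (g 0)
    \<oplus>\<^bsub>A\<^esub> star_coeff A star 1 (f 0) (g 1) \<oplus>\<^bsub>A\<^esub> f 1 \<otimes>\<^bsub>A\<^esub> g 1 \<oplus>\<^bsub>A\<^esub> (f 0 \<otimes>\<^bsub>A\<^esub> g 2 \<oplus>\<^bsub>A\<^esub> f 2 \<otimes>\<^bsub>A\<^esub> g 0)"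
proof -
  have [simp]: "nu_divide f 0 = f 1" "nu_divide g 0 = g 1"
      "nu_divide f (Suc 0) = f 2" "nu_divide g (Suc 0) = g 2"
    by (simp_all add: nu_divide_def numeral_2_eq_2)
  have "(nu_divide f \<otimes>\<^bsub>D\<^esub> c (g 0)) 1
      = f 1 \<otimes>\<^bsub>A\<^esub> \<zero>\<^bsub>A\<^esub> \<oplus>\<^bsub>A\<^esub> f 2 \<otimes>\<^bsub>A\<^esub> g 0 \<oplus>\<^bsub>A\<^esub> star_coeff A star 1 (f 1) (g 0)"
    using assms by (subst mult_1) simp_all
  moreover have "(f \<otimes>\<^bsub>D\<^esub> nu_divide g) 1
      = f 0 \<otimes>\<^bsub>A\<^esub> g 2 \<oplus>\<^bsub>A\<^esub> f 1 \<otimes>\<^bsub>A\<^esub> g 1 \<oplus>\<^bsub>A\<^esub> star_coeff A star 1 (f 0) (g 1)"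
    using assms by (subst mult_1) simp_all
  ultimately show ?thesis
    using mult_Suc[OF assms, of 1] assms by (simp add: numeral_2_eq_2 a_ac)
qed

section \<open>Coefficients of commutators\<close>

lemma bracket_coeff_eq:
  assumes "a \<in> carrier A" "b \<in> carrier A"
  shows "bracket_coeff A star i a b = star_coeff A star i a b \<ominus>\<^bsub>A\<^esub> star_coeff A star i b a"
  using assms D.m_closed[of "c b" "c a"]
  by (simp add: bracket_coeff_def star_coeff_def a_minus_deformed_algebra[of _ star u] mult_D)

lemma bracket_coeff_commutator: "bracket_coeff A star i a b = commutator D (c a) (c b) i"
  by (simp add: bracket_coeff_def commutator_def mult_D a_minus_deformed_algebra[of _ star u])

lemma bracket_coeff_closed [simp]:
  "\<lbrakk>a \<in> carrier A; b \<in> carrier A\<rbrakk> \<Longrightarrow> bracket_coeff A star i a b \<in> carrier A"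
  by (simp add: bracket_coeff_eq)

lemma const_add: "c (a \<oplus>\<^bsub>A\<^esub> b) = c a \<oplus>\<^bsub>D\<^esub> c b" if "a \<in> carrier A" "b \<in> carrier A"
  using that by (auto simp: const_series_def)

lemma bracket_coeff_add_left:
  "\<lbrakk>x \<in> carrier A; y \<in> carrier A; z \<in> carrier A\<rbrakk> \<Longrightarrow>
    bracket_coeff A star i (x \<oplus>\<^bsub>A\<^esub> y) z = bracket_coeff A star i x z \<oplus>\<^bsub>A\<^esub> bracket_coeff A star i y z"
  using D.commutator_add_left[of "c x" "c y" "c z"]
  by (simp add: bracket_coeff_commutator const_add del: add_D) simp

lemma bracket_coeff_add_right:
  "\<lbrakk>x \<in> carrier A; y \<in> carrier A; z \<in> carrier A\<rbrakk> \<Longrightarrow>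
    bracket_coeff A star i x (y \<oplus>\<^bsub>A\<^esub> z) = bracket_coeff A star i x y \<oplus>\<^bsub>A\<^esub> bracket_coeff A star i x z"
  using D.commutator_add_right[of "c x" "c y" "c z"]
  by (simp add: bracket_coeff_commutator const_add del: add_D) simp

lemma commutator_D_0:
  "\<lbrakk>f \<in> carrier D; g \<in> carrier D\<rbrakk> \<Longrightarrow> commutator D f g 0 = commutator A (f 0) (g 0)"
  by (simp add: commutator_def mult_0)

text \<open>The unit may have higher coefficients, but its constant term is forced: compare constant
  terms in the product of \<open>u\<close> with the constant series 1.\<close>

lemma one_0: "u 0 = \<one>\<^bsub>A\<^esub>"
proof -
  have u: "u \<in> carrier D"
    using D.one_closed by (simp add: one_D)
  have "u 0 \<otimes>\<^bsub>A\<^esub> \<one>\<^bsub>A\<^esub> = \<one>\<^bsub>A\<^esub>"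
    using mult_0[OF u, of "c \<one>\<^bsub>A\<^esub>"] D.l_one[of "c \<one>\<^bsub>A\<^esub>"] by (simp add: one_D)
  with u show ?thesis by simp
qed

section \<open>The Poisson structure on $Z(\mathcal A) + \nu\mathcal A[[\nu]]$\<close>

lemma H_simps [simp]:
  "f \<otimes>\<^bsub>H\<^esub> g = f \<otimes>\<^bsub>D\<^esub> g"
  "\<one>\<^bsub>H\<^esub> = \<one>\<^bsub>D\<^esub>"
  "\<zero>\<^bsub>H\<^esub> = \<zero>\<^bsub>D\<^esub>"
  "f \<oplus>\<^bsub>H\<^esub> g = f \<oplus>\<^bsub>D\<^esub> g"
  "r \<odot>\<^bsub>H\<^esub> f = r \<odot>\<^bsub>D\<^esub> f"
  by (simp_all add: H_nu_def deformed_algebra_def power_series_algebra_def)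

lemma bracket_H: "bracket H f g = nu_divide (commutator D f g)"
  by (simp add: H_nu_def)

lemma carrier_H: "carrier H = (\<Union>z\<in>center A. \<Union>g\<in>carrier D. {c z \<oplus>\<^bsub>D\<^esub> nu_times A g})"
  by (simp add: H_nu_def set_add_def' nu_ideal_def carrier_D power_series_algebra_def
      power_series_ring_simps)

lemma H_mem: "f \<in> carrier H \<longleftrightarrow> f \<in> carrier D \<and> f 0 \<in> center A"
proof
  assume "f \<in> carrier H"
  then show "f \<in> carrier D \<and> f 0 \<in> center A"
    using center_closed by (auto simp: carrier_H D_mem)
next
  assume f: "f \<in> carrier D \<and> f 0 \<in> center A"
  then have "f = c (f 0) \<oplus>\<^bsub>D\<^esub> nu_times A (nu_divide f)"
    using series_split[of f] by (simp add: nu_smult)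
  then show "f \<in> carrier H"
    using f nu_divide_closed unfolding carrier_H by blast
qed

lemma H_D: "f \<in> carrier H \<Longrightarrow> f \<in> carrier D"
  by (simp add: H_mem)

lemma H_0: "f \<in> carrier H \<Longrightarrow> f 0 \<in> center A"
  by (simp add: H_mem)

lemma smult_0:
  "\<lbrakk>r \<in> carrier S; f \<in> carrier D\<rbrakk> \<Longrightarrow> (r \<odot>\<^bsub>D\<^esub> f) 0 = r 0 \<odot>\<^bsub>A\<^esub> f 0"
  by (auto simp: smult_D power_series_ring_simps Pi_iff)

text \<open>The constant term of the commutator is \<open>commutator A (f 0) (g 0)\<close>, which
  vanishes as \<open>f 0\<close> is central, so division by \<nu> loses nothing. The second argument
  ranges over all of \<open>D\<close> so that arbitrary constant series can be inserted when closure
  of the bracket is proved.\<close>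

lemma nu_smult_bracket:
  assumes "f \<in> carrier H" "g \<in> carrier D"
  shows "\<nu> \<odot>\<^bsub>D\<^esub> bracket H f g = commutator D f g"
  using assms H_D[OF assms(1)]
  by (simp add: bracket_H nu_smult nu_times_divide commutator_D_0 commutator_center_left H_0)

lemma bracket_closed_D: "\<lbrakk>f \<in> carrier D; g \<in> carrier D\<rbrakk> \<Longrightarrow> bracket H f g \<in> carrier D"
  by (simp add: bracket_H)

lemma nu_nu_smult_bracket:
  assumes f: "f \<in> carrier H" and g: "g \<in> carrier H" and h: "h \<in> carrier D"
  shows "\<nu> \<odot>\<^bsub>D\<^esub> (\<nu> \<odot>\<^bsub>D\<^esub> bracket H f (bracket H g h)) = commutator D f (commutator D g h)"
proof -
  note [simp] = H_D[OF f] H_D[OF g] h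
  have [simp]: "bracket H g h \<in> carrier D"
    by (simp add: bracket_closed_D)
  have "commutator D f (commutator D g h) = commutator D f (\<nu> \<odot>\<^bsub>D\<^esub> bracket H g h)"
    using g by (simp add: nu_smult_bracket)
  also have "\<dots> = \<nu> \<odot>\<^bsub>D\<^esub> commutator D f (bracket H g h)"
    by (simp add: D.smult_commutator_right)
  finally show ?thesis
    using f by (simp add: nu_smult_bracket)
qed

lemma bracket_H_closed:
  assumes f: "f \<in> carrier H" and g: "g \<in> carrier H"
  shows "bracket H f g \<in> carrier H"
proof -
  txt \<open>By Jacobi, \<open>\<nu> [{f, g}, a] = [f, [g, a]] - [g, [f, a]]\<close> lies in \<open>\<nu>\<^sup>2 D\<close>, because \<open>f\<close> and \<open>g\<close>
    commute with everything modulo \<open>\<nu>\<close>.\<close>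
  note [simp] = H_D[OF f] H_D[OF g]
  note [simp del] = a_minus_D
  have b [simp]: "bracket H f g \<in> carrier D"
    by (simp add: bracket_closed_D)
  have double: "\<exists>l\<in>carrier D. commutator D p (commutator D q (c a)) = \<nu> \<odot>\<^bsub>D\<^esub> (\<nu> \<odot>\<^bsub>D\<^esub> l)"
    if "p \<in> carrier H" "q \<in> carrier H" "a \<in> carrier A" for p q a
    using that nu_nu_smult_bracket[of p q "c a"]
    by (intro bexI[of _ "bracket H p (bracket H q (c a))"]) (simp_all add: bracket_closed_D H_D)
  have "commutator A (bracket H f g 0) a = \<zero>\<^bsub>A\<^esub>" if a: "a \<in> carrier A" for a
  proof -
    note [simp] = a
    obtain l where l [simp]: "l \<in> carrier D"
      and fl: "commutator D f (commutator D g (c a)) = \<nu> \<odot>\<^bsub>D\<^esub> (\<nu> \<odot>\<^bsub>D\<^esub> l)"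
      using double f g a by blast
    obtain l' where l' [simp]: "l' \<in> carrier D"
      and gl': "commutator D g (commutator D f (c a)) = \<nu> \<odot>\<^bsub>D\<^esub> (\<nu> \<odot>\<^bsub>D\<^esub> l')"
      using double f g a by blast
    have "\<nu> \<odot>\<^bsub>D\<^esub> commutator D (bracket H f g) (c a) = commutator D (\<nu> \<odot>\<^bsub>D\<^esub> bracket H f g) (c a)"
      by (simp add: D.smult_commutator_left)
    also have "\<dots> = commutator D (commutator D f g) (c a)"
      using f by (simp add: nu_smult_bracket)
    also have "\<dots> = \<nu> \<odot>\<^bsub>D\<^esub> (\<nu> \<odot>\<^bsub>D\<^esub> (l \<ominus>\<^bsub>D\<^esub> l'))"
      by (simp add: D.commutator_commutator_left fl gl' a_minus_def D.smult_r_distr D.smult_r_minus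
          del: add_D a_inv_D)
    \<comment> \<open>One factor \<nu> is cancelled; the one that is left forces the constant term
      to vanish, and this term is the commutator of \<open>bracket H f g 0\<close> with
      \<open>a\<close>.\<close>
    finally have "commutator D (bracket H f g) (c a) = \<nu> \<odot>\<^bsub>D\<^esub> (l \<ominus>\<^bsub>D\<^esub> l')"
      by (rule nu_cancel[rotated 2]) simp_all
    then have "commutator D (bracket H f g) (c a) 0 = \<zero>\<^bsub>A\<^esub>"
      by (simp add: nu_smult)
    then show ?thesis
      by (simp add: commutator_D_0)
  qed
  then show ?thesis
    using centerI[of "bracket H f g 0"] b coeff_closed[OF b] by (simp only: H_mem)
qed

lemma abelian_group_H: "abelian_group H"
proof (rule abelian_groupI)
  fix f assume f: "f \<in> carrier H"
  then have "\<ominus>\<^bsub>D\<^esub> f \<in> carrier H"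
    using D.a_inv_closed[of f] by (simp add: H_mem center_a_inv)
  moreover have "\<ominus>\<^bsub>D\<^esub> f \<oplus>\<^bsub>H\<^esub> f = \<zero>\<^bsub>H\<^esub>"
    using D.l_neg[of f] f by (simp add: H_D)
  ultimately show "\<exists>g\<in>carrier H. g \<oplus>\<^bsub>H\<^esub> f = \<zero>\<^bsub>H\<^esub>" by blast
qed (auto simp: H_mem D_mem center_zero center_add a_ac)

lemma smult_H_closed:
  assumes "r \<in> carrier S" "f \<in> carrier H"
  shows "r \<odot>\<^bsub>D\<^esub> f \<in> carrier H"
proof -
  have "r 0 \<in> carrier R"
    using assms(1) by (auto simp: power_series_ring_simps)
  with assms show ?thesis
    by (simp add: H_mem smult_0 smult_center)
qed

lemma assoc_algebra_H: "assoc_algebra S H"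
proof -
  note [simp] = H_D
  have "ring H"
  proof (intro ringI abelian_group_H monoidI)
    fix f g assume "f \<in> carrier H" "g \<in> carrier H"
    then show "f \<otimes>\<^bsub>H\<^esub> g \<in> carrier H"
      by (simp add: H_mem mult_0 center_mult)
  next
    show "\<one>\<^bsub>H\<^esub> \<in> carrier H"
      using one_0 center_one D.one_closed by (simp add: H_mem one_D)
  qed (simp_all add: D.m_assoc D.l_distr D.r_distr del: add_D)
  moreover have "module S H"
    by (intro moduleI abelian_group_H D.R.is_cring)
      (simp_all add: smult_H_closed D.smult_l_distr D.smult_r_distr D.smult_assoc1 del: add_D)
  ultimately show ?thesis
    by (intro assoc_algebra.intro assoc_algebra_axioms.intro)
      (simp_all add: D.smult_mult_left D.smult_mult_right)
qed

lemma poisson_algebra_H: "poisson_algebra S H"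
proof -
  interpret HA: assoc_algebra S H by (rule assoc_algebra_H)
  note HA.add.m_closed [simplified H_simps, simp] HA.m_closed [simplified H_simps, simp]
    HA.smult_closed [simplified H_simps, simp]
  note [simp] = H_D bracket_H_closed nu_smult_bracket nu_nu_smult_bracket
  note [simp del] = add_D
  have smult_nu: "\<nu> \<odot>\<^bsub>D\<^esub> (r \<odot>\<^bsub>D\<^esub> f) = r \<odot>\<^bsub>D\<^esub> (\<nu> \<odot>\<^bsub>D\<^esub> f)" if "r \<in> carrier S" "f \<in> carrier D" for r f
    using that by (simp add: D.R.m_comm flip: D.smult_assoc1)
  show ?thesis
  proof (intro poisson_algebra.intro assoc_algebra_H poisson_algebra_axioms.intro)
    fix r x y z
    assume [simp]: "x \<in> carrier H"
    show "bracket H x x = \<zero>\<^bsub>H\<^esub>"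
      by (rule nu_cancel) (simp_all add: D.commutator_self del: zero_D)
    assume [simp]: "y \<in> carrier H"
    show "bracket H x y \<in> carrier H" by simp
    {
      assume [simp]: "r \<in> carrier S"
      show "bracket H (r \<odot>\<^bsub>H\<^esub> x) y = r \<odot>\<^bsub>H\<^esub> bracket H x y"
        by (rule nu_cancel) (simp_all add: D.smult_commutator_left smult_nu)
      show "bracket H x (r \<odot>\<^bsub>H\<^esub> y) = r \<odot>\<^bsub>H\<^esub> bracket H x y"
        by (rule nu_cancel) (simp_all add: D.smult_commutator_right smult_nu)
    }
    assume [simp]: "z \<in> carrier H"
    show "bracket H (x \<oplus>\<^bsub>H\<^esub> y) z = bracket H x z \<oplus>\<^bsub>H\<^esub> bracket H y z"
      by (rule nu_cancel) (simp_all add: D.smult_r_distr D.commutator_add_left)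
    show "bracket H x (y \<oplus>\<^bsub>H\<^esub> z) = bracket H x y \<oplus>\<^bsub>H\<^esub> bracket H x z"
      by (rule nu_cancel) (simp_all add: D.smult_r_distr D.commutator_add_right)
    \<comment> \<open>The flipped rules carry \<nu> into the factor that is a bracket, where it
      produces a commutator.\<close>
    show "bracket H x (y \<otimes>\<^bsub>H\<^esub> z)
        = (bracket H x y \<otimes>\<^bsub>H\<^esub> z) \<oplus>\<^bsub>H\<^esub> (y \<otimes>\<^bsub>H\<^esub> bracket H x z)"
      by (rule nu_cancel)
        (simp_all add: D.smult_r_distr D.commutator_mult_right
          flip: D.smult_mult_left[of \<nu> "bracket H x y" z] D.smult_mult_right[of \<nu> y "bracket H x z"])
    \<comment> \<open>Each term nests two brackets, so \<nu> is cancelled twice. At the end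
      \<open>nu_smult_bracket\<close> is withheld, so that both factors are consumed at once by
      \<open>nu_nu_smult_bracket\<close>.\<close>
    show "bracket H x (bracket H y z) \<oplus>\<^bsub>H\<^esub> bracket H y (bracket H z x)
        \<oplus>\<^bsub>H\<^esub> bracket H z (bracket H x y) = \<zero>\<^bsub>H\<^esub>"
      by (rule nu_cancel, simp_all del: zero_D, rule nu_cancel)
        (simp_all add: D.smult_r_distr D.commutator_jacobi del: zero_D nu_smult_bracket)
  qed
qed

section \<open>The projections onto $\Pi(\mathcal A)$ and $Z(\mathcal A)$\<close>

abbreviation "PA \<equiv> Pi_algebra A star u"
abbreviation "RA \<equiv> reduced_algebra A star"
abbreviation "Z \<equiv> center A"

lemma Pi_mem: "q \<in> carrier PA \<longleftrightarrow> (\<exists>a\<in>Z. \<exists>x\<in>carrier A. q = (a, Z +>\<^bsub>A\<^esub> x))"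
  by (auto simp: Pi_algebra_def A_RCOSETS_def')

lemma carrier_Pi: "carrier PA = p_Pi A ` carrier H"
proof
  show "carrier PA \<subseteq> p_Pi A ` carrier H"
  proof
    fix q assume "q \<in> carrier PA"
    then obtain a x where q: "a \<in> Z" "x \<in> carrier A" "q = (a, Z +>\<^bsub>A\<^esub> x)"
      unfolding Pi_mem by blast
    \<comment> \<open>The projection sees only the coefficients at 0 and 1; the later ones are
      filled with \<open>x\<close> as an arbitrary choice in \<open>A\<close>.\<close>
    define f where "f = (\<lambda>n::nat. if n = 0 then a else x)"
    have "f \<in> carrier H" "p_Pi A f = q"
      using q center_closed by (auto simp: f_def H_mem D_mem p_Pi_def)
    then show "q \<in> p_Pi A ` carrier H" by blast
  qed
  show "p_Pi A ` carrier H \<subseteq> carrier PA"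
  proof
    fix q assume "q \<in> p_Pi A ` carrier H"
    then obtain f where "f \<in> carrier D" "f 0 \<in> Z" "q = (f 0, Z +>\<^bsub>A\<^esub> f 1)"
      by (auto simp: p_Pi_def H_mem)
    then show "q \<in> carrier PA"
      unfolding Pi_mem using coeff_closed[of f 1] by blast
  qed
qed

text \<open>This is the constant term of the bracket of two constant series, central because
  \<open>H\<close> is closed under the bracket.\<close>

lemma bracket_coeff_center:
  assumes "a \<in> Z" "b \<in> Z"
  shows "bracket_coeff A star 1 a b \<in> Z"
proof -
  have "c a \<in> carrier H" "c b \<in> carrier H"
    using assms center_closed by (auto simp: H_mem)
  then have "bracket H (c a) (c b) 0 \<in> Z"
    by (intro H_0 bracket_H_closed)
  then show ?thesis
    by (simp add: bracket_H nu_divide_def bracket_coeff_commutator)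
qed

lemma p_Pi_mult:
  assumes f: "f \<in> carrier H" and g: "g \<in> carrier H"
  shows "p_Pi A f \<otimes>\<^bsub>PA\<^esub> p_Pi A g = p_Pi A (f \<otimes>\<^bsub>H\<^esub> g)"
proof -
  note [simp] = f g H_D[OF f] H_D[OF g] center_closed
  let ?op = "\<lambda>x y. f 0 \<otimes>\<^bsub>A\<^esub> y \<oplus>\<^bsub>A\<^esub> x \<otimes>\<^bsub>A\<^esub> g 0 \<oplus>\<^bsub>A\<^esub> star_coeff A star 1 (f 0) (g 0)"
  have "(\<Union>x\<in>Z +>\<^bsub>A\<^esub> f 1. \<Union>y\<in>Z +>\<^bsub>A\<^esub> g 1. Z +>\<^bsub>A\<^esub> ?op x y) = Z +>\<^bsub>A\<^esub> ?op (f 1) (g 1)"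
  proof (rule UN_center_coset2)
    fix z z' assume z: "z \<in> Z" "z' \<in> Z"
    note [simp] = z
    have "?op (z \<oplus>\<^bsub>A\<^esub> f 1) (z' \<oplus>\<^bsub>A\<^esub> g 1)
        = (f 0 \<otimes>\<^bsub>A\<^esub> z' \<oplus>\<^bsub>A\<^esub> z \<otimes>\<^bsub>A\<^esub> g 0) \<oplus>\<^bsub>A\<^esub> ?op (f 1) (g 1)"
      by (simp add: l_distr r_distr a_ac)
    \<comment> \<open>The correction from changing representatives consists of products of central
      elements, since \<open>f 0\<close> and \<open>g 0\<close> are central.\<close>
    moreover have "f 0 \<otimes>\<^bsub>A\<^esub> z' \<oplus>\<^bsub>A\<^esub> z \<otimes>\<^bsub>A\<^esub> g 0 \<in> Z"
      by (intro center_add center_mult H_0[OF f] H_0[OF g]) simp_all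
    ultimately show "\<exists>w\<in>Z. ?op (z \<oplus>\<^bsub>A\<^esub> f 1) (z' \<oplus>\<^bsub>A\<^esub> g 1) = w \<oplus>\<^bsub>A\<^esub> ?op (f 1) (g 1)"
      by blast
  qed simp_all
  moreover have "(f \<otimes>\<^bsub>D\<^esub> g) 1 = ?op (f 1) (g 1)"
    by (rule mult_1) simp_all
  ultimately show ?thesis
    by (simp add: p_Pi_def Pi_algebra_def mult_0)
qed

text \<open>As \<open>f 0\<close> and \<open>g 0\<close> are central, the terms of
  \<open>mult_1\<close> containing \<open>f 1\<close> and \<open>g 1\<close> agree for both orders
  of the factors and cancel.\<close>

lemma commutator_D_1:
  assumes f: "f \<in> carrier H" and g: "g \<in> carrier H"
  shows "commutator D f g 1 = bracket_coeff A star 1 (f 0) (g 0)"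
proof -
  note [simp] = f g H_D[OF f] H_D[OF g]
  have "commutator D f g 1 = (f \<otimes>\<^bsub>D\<^esub> g) 1 \<ominus>\<^bsub>A\<^esub> (g \<otimes>\<^bsub>D\<^esub> f) 1"
    by (simp add: commutator_def)
  also have "(f \<otimes>\<^bsub>D\<^esub> g) 1 = star_coeff A star 1 (f 0) (g 0) \<oplus>\<^bsub>A\<^esub> (f 0 \<otimes>\<^bsub>A\<^esub> g 1 \<oplus>\<^bsub>A\<^esub> f 1 \<otimes>\<^bsub>A\<^esub> g 0)"
    using mult_1[of f g] by (simp add: a_ac)
  also have "(g \<otimes>\<^bsub>D\<^esub> f) 1 = star_coeff A star 1 (g 0) (f 0) \<oplus>\<^bsub>A\<^esub> (f 0 \<otimes>\<^bsub>A\<^esub> g 1 \<oplus>\<^bsub>A\<^esub> f 1 \<otimes>\<^bsub>A\<^esub> g 0)"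
    using mult_1[of g f] center_commute[OF H_0[OF f], of "g 1"] center_commute[OF H_0[OF g], of "f 1"]
    by (simp add: a_ac)
  finally show ?thesis
    by (simp add: bracket_coeff_eq add_minus_add_cancel_right)
qed

lemma commutator_D_2:
  assumes f: "f \<in> carrier H" and g: "g \<in> carrier H"
  shows "commutator D f g 2 = bracket_coeff A star 2 (f 0) (g 0) \<oplus>\<^bsub>A\<^esub> bracket_coeff A star 1 (f 1) (g 0)
    \<oplus>\<^bsub>A\<^esub> bracket_coeff A star 1 (f 0) (g 1) \<oplus>\<^bsub>A\<^esub> commutator A (f 1) (g 1)"
proof -
  note [simp] = f g H_D[OF f] H_D[OF g]
  \<comment> \<open>Exchanging \<open>f\<close> and \<open>g\<close> in \<open>mult_2\<close> also
    exchanges the partners of the second and third summands, hence r' before q'. The common t is the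
    symmetric remainder.\<close>
  have split: "(p \<oplus>\<^bsub>A\<^esub> q \<oplus>\<^bsub>A\<^esub> r \<oplus>\<^bsub>A\<^esub> s \<oplus>\<^bsub>A\<^esub> t) \<ominus>\<^bsub>A\<^esub> (p' \<oplus>\<^bsub>A\<^esub> r' \<oplus>\<^bsub>A\<^esub> q' \<oplus>\<^bsub>A\<^esub> s' \<oplus>\<^bsub>A\<^esub> t)
      = (p \<ominus>\<^bsub>A\<^esub> p') \<oplus>\<^bsub>A\<^esub> (q \<ominus>\<^bsub>A\<^esub> q') \<oplus>\<^bsub>A\<^esub> (r \<ominus>\<^bsub>A\<^esub> r') \<oplus>\<^bsub>A\<^esub> (s \<ominus>\<^bsub>A\<^esub> s')"
    if "p \<in> carrier A" "q \<in> carrier A" "r \<in> carrier A" "s \<in> carrier A" "t \<in> carrier A"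
      "p' \<in> carrier A" "q' \<in> carrier A" "r' \<in> carrier A" "s' \<in> carrier A"
    for p q r s t p' q' r' s'
    using that by (simp add: add_minus_add_cancel_right) (simp add: a_minus_def minus_add a_ac)
  have "g 0 \<otimes>\<^bsub>A\<^esub> f 2 \<oplus>\<^bsub>A\<^esub> g 2 \<otimes>\<^bsub>A\<^esub> f 0 = f 0 \<otimes>\<^bsub>A\<^esub> g 2 \<oplus>\<^bsub>A\<^esub> f 2 \<otimes>\<^bsub>A\<^esub> g 0"
    using center_commute[OF H_0[OF f], of "g 2"] center_commute[OF H_0[OF g], of "f 2"]
    by (simp add: a_ac)
  then show ?thesis
    using mult_2[of f g] mult_2[of g f]
    by (simp add: commutator_def bracket_coeff_eq split)
qed

lemma p_Pi_bracket:
  assumes f: "f \<in> carrier H" and g: "g \<in> carrier H"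
  shows "bracket PA (p_Pi A f) (p_Pi A g) = p_Pi A (bracket H f g)"
proof -
  note [simp] = f g H_D[OF f] H_D[OF g] center_closed
  let ?op = "\<lambda>x y. bracket_coeff A star 2 (f 0) (g 0) \<oplus>\<^bsub>A\<^esub> bracket_coeff A star 1 x (g 0)
    \<oplus>\<^bsub>A\<^esub> bracket_coeff A star 1 (f 0) y \<oplus>\<^bsub>A\<^esub> commutator A x y"
  have "(\<Union>x\<in>Z +>\<^bsub>A\<^esub> f 1. \<Union>y\<in>Z +>\<^bsub>A\<^esub> g 1. Z +>\<^bsub>A\<^esub> ?op x y) = Z +>\<^bsub>A\<^esub> ?op (f 1) (g 1)"
  proof (rule UN_center_coset2)
    fix z z' assume z: "z \<in> Z" "z' \<in> Z"
    note [simp] = z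
    have "commutator A (z \<oplus>\<^bsub>A\<^esub> f 1) (z' \<oplus>\<^bsub>A\<^esub> g 1) = commutator A (f 1) (g 1)"
      by (simp add: commutator_add_left commutator_add_right commutator_center_left
          commutator_center_right)
    then have "?op (z \<oplus>\<^bsub>A\<^esub> f 1) (z' \<oplus>\<^bsub>A\<^esub> g 1)
        = (bracket_coeff A star 1 z (g 0) \<oplus>\<^bsub>A\<^esub> bracket_coeff A star 1 (f 0) z') \<oplus>\<^bsub>A\<^esub> ?op (f 1) (g 1)"
      by (simp add: bracket_coeff_add_left bracket_coeff_add_right a_ac)
    \<comment> \<open>Independence of representatives rests on the first bracket coefficient
      preserving the center.\<close>
    moreover have "bracket_coeff A star 1 z (g 0) \<oplus>\<^bsub>A\<^esub> bracket_coeff A star 1 (f 0) z' \<in> Z"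
      by (intro center_add bracket_coeff_center H_0[OF f] H_0[OF g]) simp_all
    ultimately show "\<exists>w\<in>Z. ?op (z \<oplus>\<^bsub>A\<^esub> f 1) (z' \<oplus>\<^bsub>A\<^esub> g 1) = w \<oplus>\<^bsub>A\<^esub> ?op (f 1) (g 1)"
      by blast
  qed simp_all
  \<comment> \<open>Division by \<nu> moves the commutator coefficients at 1 and 2 to the places 0
    and 1.\<close>
  moreover have "bracket H f g 0 = bracket_coeff A star 1 (f 0) (g 0)" "bracket H f g 1 = ?op (f 1) (g 1)"
    using commutator_D_1[OF f g] commutator_D_2[OF f g]
    by (simp_all add: bracket_H nu_divide_def numeral_2_eq_2)
  ultimately show ?thesis
    by (simp add: p_Pi_def Pi_algebra_def)
qed

lemma p_Pi_smult:
  assumes r: "r \<in> carrier R" and f: "f \<in> carrier H"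
  shows "r \<odot>\<^bsub>PA\<^esub> p_Pi A f = p_Pi A (const_series R r \<odot>\<^bsub>H\<^esub> f)"
proof -
  have "(\<Union>x\<in>Z +>\<^bsub>A\<^esub> f 1. Z +>\<^bsub>A\<^esub> (r \<odot>\<^bsub>A\<^esub> x)) = Z +>\<^bsub>A\<^esub> (r \<odot>\<^bsub>A\<^esub> f 1)"
    using r H_D[OF f] smult_center
    by (intro UN_center_coset) (auto simp: smult_r_distr center_closed)
  then show ?thesis
    using r H_D[OF f] by (simp add: p_Pi_def Pi_algebra_def const_smult)
qed

lemma p_Pi_add:
  assumes "f \<in> carrier H" "g \<in> carrier H"
  shows "p_Pi A f \<oplus>\<^bsub>PA\<^esub> p_Pi A g = p_Pi A (f \<oplus>\<^bsub>H\<^esub> g)"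
  using abelian_subgroup.a_rcos_sum[OF abelian_subgroup_center] assms[THEN H_D]
  by (simp add: p_Pi_def Pi_algebra_def)

lemma poisson_projection_Pi: "poisson_projection S H R PA (const_series R) (p_Pi A)"
proof (intro poisson_projection.intro poisson_projection_axioms.intro poisson_algebra_H R.is_cring
    R.const_series_ring_hom carrier_Pi p_Pi_add p_Pi_mult p_Pi_bracket p_Pi_smult)
  show "\<zero>\<^bsub>PA\<^esub> = p_Pi A \<zero>\<^bsub>H\<^esub>"
    by (simp add: p_Pi_def Pi_algebra_def a_coset_add_zero center_subset)
  show "\<one>\<^bsub>PA\<^esub> = p_Pi A \<one>\<^bsub>H\<^esub>"
    by (simp add: p_Pi_def Pi_algebra_def one_D one_0)
qed

text \<open>A central element is the first component of the image of its constant series, which lies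
  in \<open>H\<close>.\<close>

lemma carrier_reduced: "carrier RA = fst ` carrier PA"
  using H_0 center_closed
  by (force simp: reduced_algebra_def carrier_Pi p_Pi_def H_mem image_image intro!: image_eqI[of _ _ "c _"])

lemma poisson_projection_reduced: "poisson_projection R PA R RA id fst"
proof (intro poisson_projection.intro poisson_projection_axioms.intro R.is_cring carrier_reduced)
  show "poisson_algebra R PA"
    using poisson_projection_Pi by (rule poisson_projection.poisson_algebra_image)
  show "id \<in> ring_hom R R"
    by (simp add: ring_hom_def)
qed (auto simp: Pi_algebra_def reduced_algebra_def)

end

section \<open>Morphisms of deformations\<close>

theorem proposition2p24:
  fixes R :: "('r, 'k) ring_scheme"
    and A :: "('r, 'a, 'm) module_scheme"
    and A' :: "('r, 'b, 'n) module_scheme"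
    and star :: "(nat \<Rightarrow> 'a) \<Rightarrow> (nat \<Rightarrow> 'a) \<Rightarrow> nat \<Rightarrow> 'a"
    and star' :: "(nat \<Rightarrow> 'b) \<Rightarrow> (nat \<Rightarrow> 'b) \<Rightarrow> nat \<Rightarrow> 'b"
    and u :: "nat \<Rightarrow> 'a"
    and u' :: "nat \<Rightarrow> 'b"
    and F :: "(nat \<Rightarrow> 'a) \<Rightarrow> nat \<Rightarrow> 'b"
    and Fs :: "nat \<Rightarrow> 'a \<Rightarrow> 'b"
  assumes "cring R"
    and "assoc_algebra R A"
    and "assoc_algebra R A'"
    and "formal_deformation R A star u"
    and "formal_deformation R A' star' u'"
    and "\<And>i. Fs i \<in> linear_maps R A A'"
    and "\<And>f. f \<in> carrier (power_series_algebra A) \<Longrightarrow> F f = series_of_maps A' Fs f"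
    and "F \<in> algebra_hom (power_series_ring R) (deformed_algebra A star u)
               (deformed_algebra A' star' u')"
    and "Fs 0 ` center A \<subseteq> center A'"
  shows "poisson_algebra_hom (power_series_ring R) (H_nu A star u) (H_nu A' star' u') F \<and>
    (\<exists>!F_Pi. induced_map (carrier (H_nu A star u)) (p_Pi A) (p_Pi A')
        (carrier (Pi_algebra A star u)) (carrier (Pi_algebra A' star' u')) F F_Pi) \<and>
    (\<forall>F_Pi. induced_map (carrier (H_nu A star u)) (p_Pi A) (p_Pi A')
        (carrier (Pi_algebra A star u)) (carrier (Pi_algebra A' star' u')) F F_Pi \<longrightarrow>
      poisson_algebra_hom R (Pi_algebra A star u) (Pi_algebra A' star' u') F_Pi \<and>
      (\<exists>!F_red. induced_map (carrier (Pi_algebra A star u)) fst fst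
          (carrier (reduced_algebra A star)) (carrier (reduced_algebra A' star')) F_Pi F_red) \<and>
      (\<forall>F_red. induced_map (carrier (Pi_algebra A star u)) fst fst
          (carrier (reduced_algebra A star)) (carrier (reduced_algebra A' star')) F_Pi F_red \<longrightarrow>
        poisson_algebra_hom R (reduced_algebra A star) (reduced_algebra A' star') F_red))"
proof -
  interpret A1: deformation R A star u
    using assms(2,4) by (simp add: deformation_def deformation_axioms_def)
  interpret A2: deformation R A' star' u'
    using assms(3,5) by (simp add: deformation_def deformation_axioms_def)
  have Fs_closed: "Fs i x \<in> carrier A'" if "x \<in> carrier A" for i x
    using assms(6)[of i] that by (auto simp: linear_maps_def)
  have Fs0_add: "Fs 0 (x \<oplus>\<^bsub>A\<^esub> y) = Fs 0 x \<oplus>\<^bsub>A'\<^esub> Fs 0 y" if "x \<in> carrier A" "y \<in> carrier A" for x y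
    using assms(6)[of 0] that by (auto simp: linear_maps_def)
  have F_series: "F f = series_of_maps A' Fs f" if "f \<in> carrier A1.D" for f
    using assms(7) that by (simp add: deformed_algebra_def)
  have F_0: "F f 0 = Fs 0 (f 0)" if "f \<in> carrier A1.D" for f
    using that by (simp add: F_series series_of_maps_def Fs_closed)
  have F_1: "F f 1 = Fs 1 (f 0) \<oplus>\<^bsub>A'\<^esub> Fs 0 (f 1)" if "f \<in> carrier A1.D" for f
    using that by (simp add: F_series series_of_maps_def Fs_closed atMost_Suc)
  have F_ring: "F \<in> ring_hom A1.D A2.D" and F_lin: "F \<in> linear_maps A1.S A1.D A2.D"
    using assms(8) by (auto simp: algebra_hom_def)
  have F_closed [simp]: "F f \<in> carrier A2.D" if "f \<in> carrier A1.D" for f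
    using F_ring that by (rule ring_hom_closed)
  have F_smult: "F (r \<odot>\<^bsub>A1.D\<^esub> f) = r \<odot>\<^bsub>A2.D\<^esub> F f" if "r \<in> carrier A1.S" "f \<in> carrier A1.D" for r f
    using F_lin that by (auto simp: linear_maps_def)
  have F_H: "F f \<in> carrier A2.H" if "f \<in> carrier A1.H" for f
    using that assms(9) by (auto simp: A1.H_mem A2.H_mem F_0)
  have F_commutator: "F (commutator A1.D f g) = commutator A2.D (F f) (F g)"
    if [simp]: "f \<in> carrier A1.D" "g \<in> carrier A1.D" for f g
  proof -
    \<comment> \<open>Between rings a homomorphism also respects opposites, and hence the difference
      in a commutator.\<close>
    interpret h: ring_hom_ring A1.D A2.D F
      by (intro ring_hom_ringI2 F_ring A1.D.ring_axioms A2.D.ring_axioms)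
    show ?thesis
      by (simp add: commutator_def a_minus_def del: A1.add_D A2.add_D A1.a_inv_D A2.a_inv_D)
  qed
  have F_bracket: "F (bracket A1.H f g) = bracket A2.H (F f) (F g)"
    if f: "f \<in> carrier A1.H" and g: "g \<in> carrier A1.H" for f g
  proof (rule A2.nu_cancel)
    note [simp] = A1.H_D[OF f] A1.H_D[OF g]
    \<comment> \<open>Linearity over R[[\<nu>]] takes \<nu> inside \<open>F\<close>, where it turns
      the bracket into a commutator.\<close>
    have "A1.\<nu> \<odot>\<^bsub>A2.D\<^esub> F (bracket A1.H f g) = F (A1.\<nu> \<odot>\<^bsub>A1.D\<^esub> bracket A1.H f g)"
      by (simp add: F_smult A1.bracket_closed_D)
    also have "\<dots> = A1.\<nu> \<odot>\<^bsub>A2.D\<^esub> bracket A2.H (F f) (F g)"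
      using f by (simp add: A1.nu_smult_bracket A2.nu_smult_bracket F_commutator F_H)
    finally show "A1.\<nu> \<odot>\<^bsub>A2.D\<^esub> F (bracket A1.H f g) = A1.\<nu> \<odot>\<^bsub>A2.D\<^esub> bracket A2.H (F f) (F g)" .
  qed (simp_all add: A1.bracket_closed_D A2.bracket_closed_D A1.H_D[OF f] A1.H_D[OF g])
  have hom_H: "poisson_algebra_hom A1.S A1.H A2.H F"
  proof (intro poisson_algebra_hom.intro poisson_algebra_hom_axioms.intro
      A1.poisson_algebra_H A2.poisson_algebra_H F_bracket)
    show "F \<in> algebra_hom A1.S A1.H A2.H"
      using F_ring F_lin A1.H_D F_H
      unfolding algebra_hom_def ring_hom_def linear_maps_def A1.H_simps A2.H_simps by blast
  qed
  have p_Pi_F: "p_Pi A' (F f) = p_Pi A' (F g)"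
    if f: "f \<in> carrier A1.H" and g: "g \<in> carrier A1.H" and eq: "p_Pi A f = p_Pi A g" for f g
  proof -
    note [simp] = A1.H_D[OF f] A1.H_D[OF g] Fs_closed
    have eq0: "f 0 = g 0" and eq1: "center A +>\<^bsub>A\<^esub> f 1 = center A +>\<^bsub>A\<^esub> g 1"
      using eq by (simp_all add: p_Pi_def)
    have "f 1 \<in> center A +>\<^bsub>A\<^esub> f 1"
      using A1.center_zero by (force simp: a_r_coset_def')
    \<comment> \<open>Equal projections mean equal constant terms and first coefficients differing
      by a central z. By \<open>F_1\<close> the images then differ at index 1 by
      \<open>Fs 0 z\<close>, which is central by the hypothesis on \<open>Fs 0\<close>.\<close>
    then obtain z where z: "z \<in> center A" "f 1 = z \<oplus>\<^bsub>A\<^esub> g 1"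
      unfolding eq1 by (auto simp: a_r_coset_def')
    have [simp]: "Fs 0 z \<in> carrier A'" "z \<in> carrier A"
      using z A1.center_closed by auto
    have "F f 1 = Fs 0 z \<oplus>\<^bsub>A'\<^esub> F g 1"
      using z(2) by (simp only: F_1 A1.H_D[OF f] A1.H_D[OF g] eq0) (simp add: Fs0_add A2.a_ac)
    moreover have "Fs 0 z \<in> center A'"
      using z assms(9) by blast
    ultimately have "center A' +>\<^bsub>A'\<^esub> F f 1 = center A' +>\<^bsub>A'\<^esub> F g 1"
      by (simp only: A2.center_coset_add_left A2.coeff_closed F_closed A1.H_D[OF g])
    then show ?thesis
      by (simp add: p_Pi_def F_0 eq0)
  qed
  have "\<exists>!F_Pi. induced_map (carrier A1.H) (p_Pi A) (p_Pi A')
      (carrier (Pi_algebra A star u)) (carrier (Pi_algebra A' star' u')) F F_Pi"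
    by (intro ex1_induced_map A1.carrier_Pi p_Pi_F) (auto simp: A2.carrier_Pi F_H)
  moreover {
    fix F_Pi
    assume ind: "induced_map (carrier A1.H) (p_Pi A) (p_Pi A')
      (carrier (Pi_algebra A star u)) (carrier (Pi_algebra A' star' u')) F F_Pi"
    have hom_Pi: "poisson_algebra_hom R (Pi_algebra A star u) (Pi_algebra A' star' u') F_Pi"
      by (rule poisson_algebra_hom_induced[OF A1.poisson_projection_Pi A2.poisson_projection_Pi
            hom_H ind])
    \<comment> \<open>The first component of the image depends only on the first component of the
      argument, so \<open>F_Pi\<close> descends along \<open>fst\<close>; the map it induces there
      is \<open>Fs 0\<close> on the center.\<close>
    have fst_F_Pi: "fst (F_Pi q) = Fs 0 (fst q)" if q: "q \<in> carrier (Pi_algebra A star u)" for q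
    proof -
      obtain f where "f \<in> carrier A1.H" "q = p_Pi A f"
        using q unfolding A1.carrier_Pi by blast
      then show ?thesis
        using ind by (auto simp: induced_map_def p_Pi_def F_0 A1.H_D)
    qed
    have "\<exists>!F_red. induced_map (carrier (Pi_algebra A star u)) fst fst
        (carrier (reduced_algebra A star)) (carrier (reduced_algebra A' star')) F_Pi F_red"
    proof (rule ex1_induced_map[OF A1.carrier_reduced])
      fix q assume "q \<in> carrier (Pi_algebra A star u)"
      then have "F_Pi q \<in> carrier (Pi_algebra A' star' u')"
        using ind by (auto simp: induced_map_def)
      then show "fst (F_Pi q) \<in> carrier (reduced_algebra A' star')"
        by (auto simp: A2.carrier_reduced)
    qed (simp add: fst_F_Pi)
    moreover have "poisson_algebra_hom R (reduced_algebra A star) (reduced_algebra A' star') F_red"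
      if "induced_map (carrier (Pi_algebra A star u)) fst fst
        (carrier (reduced_algebra A star)) (carrier (reduced_algebra A' star')) F_Pi F_red" for F_red
      by (rule poisson_algebra_hom_induced[OF A1.poisson_projection_reduced
            A2.poisson_projection_reduced hom_Pi that])
    ultimately have "poisson_algebra_hom R (Pi_algebra A star u) (Pi_algebra A' star' u') F_Pi \<and>
      (\<exists>!F_red. induced_map (carrier (Pi_algebra A star u)) fst fst
          (carrier (reduced_algebra A star)) (carrier (reduced_algebra A' star')) F_Pi F_red) \<and>
      (\<forall>F_red. induced_map (carrier (Pi_algebra A star u)) fst fst
          (carrier (reduced_algebra A star)) (carrier (reduced_algebra A' star')) F_Pi F_red \<longrightarrow>
        poisson_algebra_hom R (reduced_algebra A star) (reduced_algebra A' star') F_red)"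
      using hom_Pi by blast
  }
  ultimately show ?thesis
    using hom_H by blast
qed

end
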